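(* There exist two slowly varying functions $\varphi,\Phi$ such that for all $k\ge1$, $$q(k)=k^{-\frac1{2\alpha}-1}\varphi(k)\qquad\text{and}\qquad Q(k)=k^{-\frac1{2\alpha}}\Phi(k).$$
   Context: A sign-decorated binary tree is a finite planar rooted tree in which every internal vertex (node) has exactly two ordered children and carries a sign $\oplus$ or $\ominus$; $\mathrm{LIS}(t)$ is the maximal number of leaves in a set of leaves whose pairwise highest common ancestors all carry $\oplus$. Fix $p\in(0,1)$. $T$ is a critical binary Bienaymé–Galton–Watson tree with i.i.d. node signs, $\mathbb P(\oplus)=p$; $q(k)=\mathbb P(\mathrm{LIS}(T)=k)$, $Q(k)=\mathbb P(\mathrm{LIS}(T)\ge k)$. $\alpha=\alpha(p)$ is the unique solution in $(1/2,1)$ of $\frac{1}{4^{1/(2\alpha)}\sqrt\pi}\frac{\Gamma(1/2-1/(2\alpha))}{\Gamma(1-1/(2\alpha))}=\frac{p}{p-1}$. A measurable $\varphi:(0,\infty)\to(0,\infty)$ is slowly varying if $\varphi(xz)/\varphi(z)\to1$ as $z\to\infty$ for every $x>0$. *)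

theory Defs
  imports "HOL-Analysis.Analysis"
begin

text \<open>Sign-decorated binary trees: a leaf, or an internal node carrying a sign
(True = plus, False = minus) with an ordered pair of children.\<close>
datatype stree = Leaf | Node bool stree stree

fun leaves :: "stree \<Rightarrow> bool list set" where
  "leaves Leaf = {[]}"
| "leaves (Node s l r) = (Cons False ` leaves l) \<union> (Cons True ` leaves r)"

text \<open>Sign of the internal vertex at a given address (value irrelevant elsewhere).\<close>
fun sign_at :: "stree \<Rightarrow> bool list \<Rightarrow> bool" where
  "sign_at Leaf _ = False"
| "sign_at (Node s l r) [] = s"
| "sign_at (Node s l r) (False # p) = sign_at l p"
| "sign_at (Node s l r) (True # p) = sign_at r p"

text \<open>Highest common ancestor of two vertices = longest common prefix of addresses.\<close>
fun lcp :: "bool list \<Rightarrow> bool list \<Rightarrow> bool list" where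
  "lcp (a # u) (b # v) = (if a = b then a # lcp u v else [])"
| "lcp _ _ = []"

definition LIS :: "stree \<Rightarrow> nat" where
  "LIS t = Max {card S | S. S \<subseteq> leaves t \<and>
      (\<forall>u\<in>S. \<forall>v\<in>S. u \<noteq> v \<longrightarrow> sign_at t (lcp u v))}"

fun nplus :: "stree \<Rightarrow> nat" where
  "nplus Leaf = 0"
| "nplus (Node s l r) = (if s then 1 else 0) + nplus l + nplus r"

fun nminus :: "stree \<Rightarrow> nat" where
  "nminus Leaf = 0"
| "nminus (Node s l r) = (if s then 0 else 1) + nminus l + nminus r"

text \<open>Law of the critical binary BGW tree (0 or 2 children w.p. 1/2 each) with i.i.d.
signs, P(plus) = p: a tree with n internal vertices has 2n+1 vertices, so
P(T = t) = (1/2)^(2n+1) * p^(#plus) * (1-p)^(#minus).\<close>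
definition bgw_prob :: "real \<Rightarrow> stree \<Rightarrow> real" where
  "bgw_prob p t = (1/2) ^ (2 * (nplus t + nminus t) + 1) * p ^ nplus t * (1 - p) ^ nminus t"

definition q_LIS :: "real \<Rightarrow> nat \<Rightarrow> real" where
  "q_LIS p k = (\<Sum>\<^sub>\<infinity> t \<in> {t. LIS t = k}. bgw_prob p t)"

definition Q_LIS :: "real \<Rightarrow> nat \<Rightarrow> real" where
  "Q_LIS p k = (\<Sum>\<^sub>\<infinity> t \<in> {t. LIS t \<ge> k}. bgw_prob p t)"

definition alpha :: "real \<Rightarrow> real" where
  "alpha p = (THE a. 1/2 < a \<and> a < 1 \<and>
     1 / (4 powr (1 / (2*a)) * sqrt pi) * (Gamma (1/2 - 1/(2*a)) / Gamma (1 - 1/(2*a)))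
       = p / (p - 1))"

definition slowly_varying :: "(real \<Rightarrow> real) \<Rightarrow> bool" where
  "slowly_varying \<phi> \<longleftrightarrow>
     \<phi> \<in> borel_measurable (restrict_space borel {0<..}) \<and>
     (\<forall>x>0. \<phi> x > 0) \<and>
     (\<forall>x>0. ((\<lambda>z. \<phi> (x * z) / \<phi> z) \<longlongrightarrow> 1) at_top)"

end

theory Submission
  imports Defs
begin

text \<open>
  Put \<open>\<theta> = (1 - p) / p\<close>. Splitting a tree at its root gives the quadratic recursion
  \<open>\<Sum>i<k. q i * q (k - i) = q k * (2 + \<theta> * (Q k + Q (k + 1)))\<close> for \<open>k \<ge> 2\<close>; summed once and twice, it becomes
  \<open>\<Sum>i<k. Q i * q (k - i) = Q k + \<theta> * (Q k)\<^sup>2\<close> and \<open>c (k - 1) - c k = \<theta> * (Q k)\<^sup>2\<close>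
  for \<open>c k = (\<Sum>j\<le>k. Q j * Q (k + 1 - j))\<close>.

  Everything follows once the local exponent \<open>e k = k * q k / Q k\<close> is shown to converge to \<open>1 / (2 * \<alpha>)\<close>.
  Multiplying the first identity by \<open>k\<close> and symmetrising shows that \<open>e k\<close> is, up to a small
  error, an average of \<open>e i\<close> for \<open>i < k\<close> with the positive weights \<open>Q i * q (k - i)\<close>. This bounds
  \<open>e\<close> above and below by positive constants. It also yields a strong maximum principle: at indices \<open>k\<close>
  where \<open>e k\<close> is close to its upper (or lower) limit \<open>S\<close>, almost all earlier \<open>e i\<close> are close to \<open>S\<close> as well,
  so that \<open>Q (x * k) / Q k\<close> tends to \<open>x powr - S\<close> for every \<open>x\<close> in \<open>(0, 1]\<close>. Then \<open>c k / (k * (Q k)\<^sup>2)\<close>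
  tends to \<open>Beta (1 - S) (1 - S)\<close>, and the identity for \<open>c\<close> forces \<open>(2 * S - 1) * Beta (1 - S) (1 - S) = \<theta>\<close>.
  By Legendre duplication this is the equation that defines \<open>\<alpha>\<close>, with \<open>S = 1 / (2 * \<alpha>)\<close>; its solution is
  unique, so the upper and lower limits of \<open>e\<close> coincide.
\<close>

subsection \<open>Decomposition of trees at the root\<close>

text \<open>The sets over which \<open>LIS\<close> maximises, named so that they can be cut into a
  left and a right part at the root.\<close>

definition plus_set :: "stree \<Rightarrow> bool list set \<Rightarrow> bool" where
  "plus_set t S \<longleftrightarrow> S \<subseteq> leaves t \<and> (\<forall>u\<in>S. \<forall>v\<in>S. u \<noteq> v \<longrightarrow> sign_at t (lcp u v))"

lemma finite_leaves: "finite (leaves t)"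
  by (induction t) auto

lemma finite_plus_set: "plus_set t S \<Longrightarrow> finite S"
  by (metis finite_leaves finite_subset plus_set_def)

lemma LIS_alt: "LIS t = Max {card S | S. plus_set t S}"
  by (simp add: LIS_def plus_set_def)

lemma finite_plus_set_cards: "finite {card S | S. plus_set t S}"
proof -
  have "{card S | S. plus_set t S} \<subseteq> card ` Pow (leaves t)"
    by (auto simp: plus_set_def)
  then show ?thesis
    by (rule finite_subset) (simp add: finite_leaves)
qed

lemma card_le_LIS: "plus_set t S \<Longrightarrow> card S \<le> LIS t"
  unfolding LIS_alt by (rule Max_ge[OF finite_plus_set_cards]) auto

lemma LIS_witness: obtains S where "plus_set t S" "card S = LIS t"
proof -
  have "plus_set t {}" by (simp add: plus_set_def)
  then have "LIS t \<in> {card S | S. plus_set t S}"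
    unfolding LIS_alt by (intro Max_in finite_plus_set_cards) blast
  then show ?thesis using that by auto
qed

lemma LIS_eqI:
  assumes "plus_set t S" "card S = n" "\<And>S. plus_set t S \<Longrightarrow> card S \<le> n"
  shows "LIS t = n"
proof (rule antisym)
  obtain S' where "plus_set t S'" "card S' = LIS t" by (rule LIS_witness)
  then show "LIS t \<le> n" using assms(3) by metis
  show "n \<le> LIS t" using card_le_LIS[OF assms(1)] assms(2) by simp
qed

lemma LIS_Leaf: "LIS Leaf = 1"
proof (rule LIS_eqI[of _ "{[]}"])
  show "card S \<le> 1" if "plus_set Leaf S" for S
    using that card_mono[of "{[]}" S] by (simp add: plus_set_def)
qed (simp_all add: plus_set_def)

text \<open>A leaf of \<open>l\<close> and a leaf of \<open>r\<close> meet at the root, so the sign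
  \<open>s\<close> matters exactly when both parts are nonempty; pairs on one side only see signs
  inside their own subtree.\<close>

lemma plus_set_Node_iff:
  "plus_set (Node s l r) (Cons False ` A \<union> Cons True ` B) \<longleftrightarrow>
     plus_set l A \<and> plus_set r B \<and> (s \<or> A = {} \<or> B = {})"
  (is "?L \<longleftrightarrow> ?R")
proof
  assume ?L
  then have sub: "Cons False ` A \<union> Cons True ` B \<subseteq> leaves (Node s l r)"
    and sign: "\<And>u v. u \<in> Cons False ` A \<union> Cons True ` B \<Longrightarrow> v \<in> Cons False ` A \<union> Cons True ` B \<Longrightarrow>
      u \<noteq> v \<Longrightarrow> sign_at (Node s l r) (lcp u v)"
    by (simp_all add: plus_set_def)
  have "sign_at l (lcp u v)" if "u \<in> A" "v \<in> A" "u \<noteq> v" for u v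
    using sign[of "False # u" "False # v"] that by simp
  moreover have "sign_at r (lcp u v)" if "u \<in> B" "v \<in> B" "u \<noteq> v" for u v
    using sign[of "True # u" "True # v"] that by simp
  moreover have "s" if "u \<in> A" "v \<in> B" for u v
    using sign[of "False # u" "True # v"] that by simp
  moreover have "A \<subseteq> leaves l" "B \<subseteq> leaves r"
    using sub by auto
  ultimately show ?R
    unfolding plus_set_def by blast
next
  assume R: ?R
  then have "s" if "u \<in> A" "v \<in> B" for u v
    using that by blast
  with R show ?L
    unfolding plus_set_def by (auto simp del: not_Cons_self) (blast+)
qed

lemma plus_set_Node_split:
  assumes "plus_set (Node s l r) S"
  obtains A B where "S = Cons False ` A \<union> Cons True ` B"
proof -
  have "S \<subseteq> range (Cons False) \<union> range (Cons True)"
    using assms by (auto simp: plus_set_def)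
  then have "S = Cons False ` (Cons False -` S) \<union> Cons True ` (Cons True -` S)"
    unfolding image_vimage_eq by blast
  then show ?thesis by (rule that)
qed

lemma card_Cons_Un:
  assumes "finite A" "finite B"
  shows "card (Cons False ` A \<union> Cons True ` B) = card A + card B"
  using assms by (subst card_Un_disjoint) (auto simp: card_image)

text \<open>A plus root lets optimal sets of the two subtrees be united; a minus root forces one
  part to be empty, so only the better subtree counts.\<close>

lemma LIS_Node: "LIS (Node s l r) = (if s then LIS l + LIS r else max (LIS l) (LIS r))"
proof -
  obtain A where A: "plus_set l A" "card A = LIS l" by (rule LIS_witness)
  obtain B where B: "plus_set r B" "card B = LIS r" by (rule LIS_witness)
  have empty: "plus_set t {}" for t by (simp add: plus_set_def)
  note fin = finite_plus_set[OF A(1)] finite_plus_set[OF B(1)]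
  have upper: "card S \<le> (if s then LIS l + LIS r else max (LIS l) (LIS r))"
    if "plus_set (Node s l r) S" for S
  proof -
    obtain A' B' where S: "S = Cons False ` A' \<union> Cons True ` B'"
      using plus_set_Node_split \<open>plus_set (Node s l r) S\<close> by blast
    then have *: "plus_set l A'" "plus_set r B'" "s \<or> A' = {} \<or> B' = {}"
      using that plus_set_Node_iff by auto
    then have "card S = card A' + card B'"
      unfolding S by (intro card_Cons_Un finite_plus_set)
    then show ?thesis
      using * card_le_LIS[OF *(1)] card_le_LIS[OF *(2)] by (auto simp: max_def)
  qed
  show ?thesis
  proof (cases s)
    case True
    show ?thesis
      by (rule LIS_eqI[of _ "Cons False ` A \<union> Cons True ` B", OF _ _ upper])
        (use True A B fin in \<open>auto simp: plus_set_Node_iff card_Cons_Un\<close>)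
  next
    case False
    show ?thesis
    proof (cases "LIS l \<le> LIS r")
      case True
      show ?thesis
        by (rule LIS_eqI[of _ "Cons False ` {} \<union> Cons True ` B", OF _ _ upper], subst plus_set_Node_iff)
          (use \<open>\<not> s\<close> True A B fin empty in \<open>auto simp: card_image\<close>)
    next
      case F: False
      show ?thesis
        by (rule LIS_eqI[of _ "Cons False ` A \<union> Cons True ` {}", OF _ _ upper], subst plus_set_Node_iff)
          (use \<open>\<not> s\<close> F A B fin empty in \<open>auto simp: card_image\<close>)
    qed
  qed
qed

lemma LIS_pos: "LIS t \<ge> 1"
  by (induction t) (auto simp: LIS_Leaf LIS_Node)

section \<open>Law of the tree: summability, total mass and the recursion for
  \<open>q_LIS\<close>\<close>

lemma bgw_prob_Leaf: "bgw_prob p Leaf = 1/2"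
  by (simp add: bgw_prob_def)

lemma bgw_prob_Node:
  "bgw_prob p (Node s l r) = (if s then p else 1 - p) / 2 * (bgw_prob p l * bgw_prob p r)"
  by (cases s) (simp_all add: bgw_prob_def power_add field_simps)

text \<open>Trees of height less than the argument (a leaf has height 0): a finite exhaustion of all
  trees, used to bound the finite partial sums of \<open>bgw_prob p\<close>.\<close>

fun trees_upto :: "nat \<Rightarrow> stree set" where
  "trees_upto 0 = {}"
| "trees_upto (Suc h) = insert Leaf ((\<lambda>(s, l, r). Node s l r) ` (UNIV \<times> trees_upto h \<times> trees_upto h))"

lemma finite_trees_upto: "finite (trees_upto h)"
  by (induction h) auto

lemma trees_upto_Suc: "trees_upto h \<subseteq> trees_upto (Suc h)"
proof (induction h)
  case (Suc h)
  then show ?case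
    unfolding trees_upto.simps by (intro insert_mono image_mono Sigma_mono) auto
qed auto

lemma trees_upto_mono: "h \<le> h' \<Longrightarrow> trees_upto h \<subseteq> trees_upto h'"
  using lift_Suc_mono_le[of trees_upto h h'] trees_upto_Suc by blast

lemma ex_trees_upto: "\<exists>h. t \<in> trees_upto h"
proof (induction t)
  case Leaf
  have "Leaf \<in> trees_upto (Suc 0)" by simp
  then show ?case by blast
next
  case (Node s l r)
  then obtain h h' where "l \<in> trees_upto h" "r \<in> trees_upto h'" by blast
  then have "l \<in> trees_upto (max h h')" "r \<in> trees_upto (max h h')"
    using trees_upto_mono[of h "max h h'"] trees_upto_mono[of h' "max h h'"] by auto
  then have "Node s l r \<in> trees_upto (Suc (max h h'))" by force
  then show ?case by blast
qed

lemma finite_subset_trees_upto: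
  assumes "finite F" shows "\<exists>h. F \<subseteq> trees_upto h"
  using assms
proof (induction F rule: finite_induct)
  case (insert t F)
  then obtain h where h: "F \<subseteq> trees_upto h" by blast
  obtain h' where h': "t \<in> trees_upto h'" using ex_trees_upto by blast
  have "insert t F \<subseteq> trees_upto (max h h')"
    using h h' trees_upto_mono[of h "max h h'"] trees_upto_mono[of h' "max h h'"] by auto
  then show ?case by blast
qed auto

context
  fixes p :: real
  assumes p: "0 < p" "p < 1"
begin

lemma bgw_prob_pos: "bgw_prob p t > 0"
  using p by (simp add: bgw_prob_def)

text \<open>A mass \<open>m\<close> at one height becomes \<open>1/2 + m * m / 2\<close> at the
  next, and this map sends the unit interval into itself.\<close>

lemma sum_bgw_prob_trees_upto: "sum (bgw_prob p) (trees_upto h) \<le> 1"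
proof (induction h)
  case (Suc h)
  define S where "S = sum (bgw_prob p) (trees_upto h)"
  have S0: "S \<ge> 0"
    unfolding S_def by (intro sum_nonneg) (simp add: bgw_prob_pos less_imp_le)
  have inj: "inj_on (\<lambda>(s, l, r). Node s l r) (UNIV \<times> trees_upto h \<times> trees_upto h)"
    by (auto simp: inj_on_def)
  have "sum (bgw_prob p) (trees_upto (Suc h)) =
      1/2 + sum (bgw_prob p) ((\<lambda>(s, l, r). Node s l r) ` (UNIV \<times> trees_upto h \<times> trees_upto h))"
    by (simp only: trees_upto.simps, subst sum.insert) (auto simp: finite_trees_upto bgw_prob_Leaf)
  also have "\<dots> = 1/2 + (\<Sum>(s, l, r)\<in>UNIV \<times> trees_upto h \<times> trees_upto h. bgw_prob p (Node s l r))"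
    unfolding sum.reindex[OF inj] by (simp add: o_def case_prod_unfold)
  also have "\<dots> = 1/2 + (\<Sum>s\<in>UNIV. \<Sum>l\<in>trees_upto h. \<Sum>r\<in>trees_upto h. bgw_prob p (Node s l r))"
    by (simp only: sum.cartesian_product)
  also have "\<dots> = 1/2 + (\<Sum>s\<in>UNIV. (if s then p else 1 - p) / 2 * (S * S))"
    by (intro arg_cong2[of _ _ _ _ plus] sum.cong refl)
       (simp only: bgw_prob_Node S_def sum_product, simp only: sum_distrib_left)
  also have "\<dots> = 1/2 + S * S / 2"
    by (simp add: UNIV_bool field_simps)
  also have "\<dots> \<le> 1"
    using mult_mono[OF Suc.IH Suc.IH] S0 by (simp add: S_def)
  finally show ?case .
qed auto

lemma bgw_prob_summable: "bgw_prob p summable_on A"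
proof (rule summable_on_subset_banach[of _ UNIV])
  show "bgw_prob p summable_on UNIV"
  proof (rule nonneg_bdd_above_summable_on)
    show "bdd_above (sum (bgw_prob p) ` {F. F \<subseteq> UNIV \<and> finite F})"
    proof (rule bdd_aboveI[of _ 1], clarify)
      fix F :: "stree set" assume "finite F"
      then obtain h where "F \<subseteq> trees_upto h" using finite_subset_trees_upto by blast
      then have "sum (bgw_prob p) F \<le> sum (bgw_prob p) (trees_upto h)"
        by (intro sum_mono2 finite_trees_upto) (auto simp: bgw_prob_pos less_imp_le)
      with sum_bgw_prob_trees_upto[of h] show "sum (bgw_prob p) F \<le> 1" by linarith
    qed
  qed (simp add: bgw_prob_pos less_imp_le)
qed auto

lemma bgw_prob_has_sum_Times:
  "((\<lambda>(l, r). bgw_prob p l * bgw_prob p r) has_sum (infsum (bgw_prob p) A * infsum (bgw_prob p) B)) (A \<times> B)"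
proof -
  have inner: "((\<lambda>r. bgw_prob p l * bgw_prob p r) has_sum (bgw_prob p l * infsum (bgw_prob p) B)) B" for l
    by (intro has_sum_cmult_right has_sum_infsum bgw_prob_summable)
  have outer: "((\<lambda>l. bgw_prob p l * infsum (bgw_prob p) B) has_sum (infsum (bgw_prob p) A * infsum (bgw_prob p) B)) A"
    by (intro has_sum_cmult_left has_sum_infsum bgw_prob_summable)
  have summ: "(\<lambda>(l, r). bgw_prob p l * bgw_prob p r) summable_on A \<times> B"
    by (rule summable_on_SigmaI[where g = "\<lambda>l. bgw_prob p l * infsum (bgw_prob p) B"])
       (use inner outer in \<open>auto simp: summable_on_def less_imp_le bgw_prob_pos\<close>)
  show ?thesis
    by (rule has_sum_SigmaI[where g = "\<lambda>l. bgw_prob p l * infsum (bgw_prob p) B"])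
      (use inner outer summ in auto)
qed

lemma bgw_prob_pair_summable: "(\<lambda>(l, r). bgw_prob p l * bgw_prob p r) summable_on X"
  by (rule summable_on_subset_banach[OF has_sum_imp_summable[OF bgw_prob_has_sum_Times[of UNIV UNIV]]]) simp

text \<open>Trees are sorted into the leaf, those with a plus root and those with a minus root. A
  general predicate \<open>P\<close> serves both the total mass (\<open>P\<close> always true) and
  the law of a single value.\<close>

lemma infsum_LIS_split:
  "infsum (bgw_prob p) {t. P (LIS t)} = (if P 1 then 1/2 else 0)
     + p / 2 * infsum (\<lambda>(l, r). bgw_prob p l * bgw_prob p r) {(l, r). P (LIS l + LIS r)}
     + (1 - p) / 2 * infsum (\<lambda>(l, r). bgw_prob p l * bgw_prob p r) {(l, r). P (max (LIS l) (LIS r))}"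
proof (rule infsumI)
  define w where "w = (\<lambda>(l, r). bgw_prob p l * bgw_prob p r)"
  define node where "node s = (\<lambda>(l, r). Node s l r)" for s
  have node: "(bgw_prob p has_sum ((if s then p else 1 - p) / 2 * infsum w X)) (node s ` X)" for s X
  proof -
    have "inj_on (node s) X" by (auto simp: inj_on_def node_def)
    moreover have "bgw_prob p \<circ> node s = (\<lambda>x. (if s then p else 1 - p) / 2 * w x)"
      by (auto simp: fun_eq_iff w_def node_def bgw_prob_Node)
    moreover have "((\<lambda>x. (if s then p else 1 - p) / 2 * w x) has_sum ((if s then p else 1 - p) / 2 * infsum w X)) X"
      unfolding w_def by (intro has_sum_cmult_right has_sum_infsum bgw_prob_pair_summable)
    ultimately show ?thesis by (simp add: has_sum_reindex)
  qed
  have leaf: "(bgw_prob p has_sum (if P 1 then 1/2 else 0)) (if P 1 then {Leaf} else {})"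
    by (rule has_sum_finiteI) (auto simp: bgw_prob_Leaf)
  define XT where "XT = {(l, r). P (LIS l + LIS r)}"
  define XF where "XF = {(l, r). P (max (LIS l) (LIS r))}"
  have "{t. P (LIS t)} = ((if P 1 then {Leaf} else {}) \<union> node True ` XT) \<union> node False ` XF"
  proof (rule set_eqI)
    fix t show "t \<in> {t. P (LIS t)} \<longleftrightarrow> t \<in> ((if P 1 then {Leaf} else {}) \<union> node True ` XT) \<union> node False ` XF"
    proof (cases t)
      case (Node s l r)
      then show ?thesis
        by (cases s) (auto simp: node_def XT_def XF_def LIS_Node image_iff)
    qed (auto simp: node_def LIS_Leaf)
  qed
  moreover have "(bgw_prob p has_sum ((if P 1 then 1/2 else 0) + (if True then p else 1 - p) / 2 * infsum w XT
      + (if False then p else 1 - p) / 2 * infsum w XF))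
      (((if P 1 then {Leaf} else {}) \<union> node True ` XT) \<union> node False ` XF)"
    by (intro has_sum_Un_disjoint leaf node) (auto simp: node_def)
  ultimately show "(bgw_prob p has_sum ((if P 1 then 1/2 else 0)
     + p / 2 * infsum (\<lambda>(l, r). bgw_prob p l * bgw_prob p r) {(l, r). P (LIS l + LIS r)}
     + (1 - p) / 2 * infsum (\<lambda>(l, r). bgw_prob p l * bgw_prob p r) {(l, r). P (max (LIS l) (LIS r))}))
     {t. P (LIS t)}"
    by (simp add: w_def XT_def XF_def)
qed

lemma infsum_bgw_prob_Times:
  "infsum (\<lambda>(l, r). bgw_prob p l * bgw_prob p r) (A \<times> B) = infsum (bgw_prob p) A * infsum (bgw_prob p) B"
  by (rule infsumI[OF bgw_prob_has_sum_Times])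

text \<open>Criticality: the total mass \<open>m\<close> solves \<open>m = 1/2 + m * m / 2\<close>,
  whose only root is the double root 1.\<close>

lemma infsum_bgw_prob_UNIV: "infsum (bgw_prob p) UNIV = 1"
proof -
  define m where "m = infsum (bgw_prob p) UNIV"
  have "infsum (\<lambda>(l, r). bgw_prob p l * bgw_prob p r) UNIV = m * m"
    using infsum_bgw_prob_Times[of UNIV UNIV] by (simp add: m_def)
  then have "m = 1/2 + p / 2 * (m * m) + (1 - p) / 2 * (m * m)"
    using infsum_LIS_split[of "\<lambda>_. True"] by (simp add: m_def)
  then have "(m - 1) * (m - 1) = 0" by (simp add: field_simps)
  then show ?thesis by (simp add: m_def)
qed

lemma Q_LIS_1: "Q_LIS p 1 = 1"
proof -
  have "{t. 1 \<le> LIS t} = UNIV" using LIS_pos by auto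
  then show ?thesis by (simp add: Q_LIS_def infsum_bgw_prob_UNIV)
qed

lemma Q_LIS_Suc: "Q_LIS p (Suc k) = Q_LIS p k - q_LIS p k"
proof -
  have "{t. k \<le> LIS t} = {t. LIS t = k} \<union> {t. Suc k \<le> LIS t}" by auto
  then have "Q_LIS p k = infsum (bgw_prob p) ({t. LIS t = k} \<union> {t. Suc k \<le> LIS t})"
    by (simp only: Q_LIS_def)
  also have "\<dots> = q_LIS p k + Q_LIS p (Suc k)"
    unfolding q_LIS_def Q_LIS_def by (intro infsum_Un_disjoint bgw_prob_summable) auto
  finally show ?thesis by simp
qed

lemma infsum_LIS_less: "infsum (bgw_prob p) {t. LIS t < k} = 1 - Q_LIS p k"
proof -
  have "infsum (bgw_prob p) {t. LIS t < k} + Q_LIS p k = infsum (bgw_prob p) ({t. LIS t < k} \<union> {t. k \<le> LIS t})"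
    unfolding Q_LIS_def by (intro infsum_Un_disjoint[symmetric] bgw_prob_summable) auto
  also have "{t. LIS t < k} \<union> {t. k \<le> LIS t} = UNIV" by auto
  finally show ?thesis by (simp add: infsum_bgw_prob_UNIV)
qed

lemma infsum_LIS_plus:
  "infsum (\<lambda>(l, r). bgw_prob p l * bgw_prob p r) {(l, r). LIS l + LIS r = k} = (\<Sum>i=1..<k. q_LIS p i * q_LIS p (k - i))"
proof -
  have "(\<Sum>i=1..<k. q_LIS p i * q_LIS p (k - i)) =
      (\<Sum>i=1..<k. infsum (\<lambda>(l, r). bgw_prob p l * bgw_prob p r) ({t. LIS t = i} \<times> {t. LIS t = k - i}))"
    by (simp add: infsum_bgw_prob_Times q_LIS_def)
  also have "\<dots> = infsum (\<lambda>(l, r). bgw_prob p l * bgw_prob p r) (\<Union>i\<in>{1..<k}. {t. LIS t = i} \<times> {t. LIS t = k - i})"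
    by (intro sum_infsum bgw_prob_pair_summable) auto
  also have "(\<Union>i\<in>{1..<k}. {t. LIS t = i} \<times> {t. LIS t = k - i}) = {(l, r). LIS l + LIS r = k}"
  proof (intro equalityI subsetI)
    fix x assume "x \<in> {(l, r). LIS l + LIS r = k}"
    then obtain l r where x: "x = (l, r)" "LIS l + LIS r = k" by auto
    then have "LIS l \<in> {1..<k}" "LIS r = k - LIS l" using LIS_pos[of l] LIS_pos[of r] by auto
    then show "x \<in> (\<Union>i\<in>{1..<k}. {t. LIS t = i} \<times> {t. LIS t = k - i})" using x by auto
  qed auto
  finally show ?thesis by simp
qed

text \<open>The maximum equals \<open>k\<close> on a square of pairs minus a smaller nested square,
  and on each square the weight factorises.\<close>

lemma infsum_LIS_max:
  "infsum (\<lambda>(l, r). bgw_prob p l * bgw_prob p r) {(l, r). max (LIS l) (LIS r) = k} =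
    (1 - Q_LIS p (Suc k))\<^sup>2 - (1 - Q_LIS p k)\<^sup>2"
proof -
  have eq: "{(l, r). max (LIS l) (LIS r) = k} =
      {t. LIS t < Suc k} \<times> {t. LIS t < Suc k} - {t. LIS t < k} \<times> {t. LIS t < k}"
    by (auto simp: max_def)
  show ?thesis
    unfolding eq power2_eq_square infsum_LIS_less[symmetric] infsum_bgw_prob_Times[symmetric]
    by (intro infsum_Diff bgw_prob_pair_summable Sigma_mono) auto
qed

lemma q_LIS_rec:
  "q_LIS p k = (if k = 1 then 1/2 else 0) + p / 2 * (\<Sum>i=1..<k. q_LIS p i * q_LIS p (k - i))
    + (1 - p) / 2 * ((1 - Q_LIS p (Suc k))\<^sup>2 - (1 - Q_LIS p k)\<^sup>2)"
  using infsum_LIS_split[of "\<lambda>n. n = k"] by (simp add: q_LIS_def[symmetric] infsum_LIS_plus infsum_LIS_max eq_commute[of 1 k])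

lemma Q_LIS_nonneg: "Q_LIS p k \<ge> 0"
  unfolding Q_LIS_def by (intro infsum_nonneg) (simp add: bgw_prob_pos less_imp_le)

end

subsection \<open>The equation for the exponent\<close>

text \<open>The complex duplication formula, restricted to the real axis through the embedding
  \<open>complex_of_real\<close>.\<close>

lemma Gamma_legendre_duplication_real:
  fixes x :: real
  assumes "x \<notin> \<int>\<^sub>\<le>\<^sub>0" "x + 1/2 \<notin> \<int>\<^sub>\<le>\<^sub>0"
  shows "Gamma x * Gamma (x + 1/2) = exp ((1 - 2 * x) * ln 2) * sqrt pi * Gamma (2 * x)"
proof -
  have nonpos: "complex_of_real y \<notin> \<int>\<^sub>\<le>\<^sub>0" if "y \<notin> \<int>\<^sub>\<le>\<^sub>0" for y
    using that by (metis of_real_in_nonpos_Ints_iff)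
  have "complex_of_real x + 1/2 = complex_of_real (x + 1/2)" by simp
  then have "Gamma (complex_of_real x) * Gamma (complex_of_real (x + 1/2)) =
      exp ((1 - 2 * complex_of_real x) * of_real (ln 2)) * of_real (sqrt pi) * Gamma (2 * complex_of_real x)"
    using Gamma_legendre_duplication[of "complex_of_real x"] nonpos[OF assms(1)] nonpos[OF assms(2)] by metis
  moreover have "Gamma (2 * complex_of_real x) = complex_of_real (Gamma (2 * x))"
    using Gamma_complex_of_real[of "2 * x"] by simp
  moreover have "(1 - 2 * complex_of_real x) * of_real (ln 2) = complex_of_real ((1 - 2 * x) * ln 2)" by simp
  ultimately have "complex_of_real (Gamma x * Gamma (x + 1/2)) =
      complex_of_real (exp ((1 - 2 * x) * ln 2) * sqrt pi * Gamma (2 * x))"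
    by (simp only: Gamma_complex_of_real exp_of_real) (simp only: of_real_mult)
  then show ?thesis by (simp only: of_real_eq_iff)
qed

text \<open>The linear factor grows strictly, and the positive factor \<open>Beta\<close> does not
  decrease when its positive arguments shrink.\<close>

lemma Beta_char_mono:
  fixes a b :: real
  assumes "1/2 < a" "a < b" "b < 1"
  shows "(2 * a - 1) * Beta (1 - a) (1 - a) < (2 * b - 1) * Beta (1 - b) (1 - b)"
proof (rule mult_less_le_imp_less)
  show "Beta (1 - a) (1 - a) \<le> Beta (1 - b) (1 - b)"
    using assms by (intro Beta_real_mono) auto
  show "0 < Beta (1 - a) (1 - a)"
    using assms unfolding Beta_def by (intro divide_pos_pos mult_pos_pos Gamma_real_pos) auto
qed (use assms in auto)

text \<open>Used twice: the equation for \<alpha> has only one solution, and the upper and lower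
  limits of the local exponent coincide.\<close>

lemma Beta_char_inj:
  fixes a b :: real
  assumes "1/2 < a" "a < 1" "1/2 < b" "b < 1"
    and "(2 * a - 1) * Beta (1 - a) (1 - a) = (2 * b - 1) * Beta (1 - b) (1 - b)"
  shows "a = b"
  using assms Beta_char_mono[of a b] Beta_char_mono[of b a] by (cases a b rule: linorder_cases) auto

lemma notin_nonpos_Ints_between:
  fixes x :: real
  assumes "-1 < x" "x < 0" shows "x \<notin> \<int>\<^sub>\<le>\<^sub>0"
proof
  assume "x \<in> \<int>\<^sub>\<le>\<^sub>0"
  then obtain n where "x = of_int n" by (elim nonpos_Ints_cases)
  with assms show False by simp
qed

text \<open>With \<open>b = 1 / (2 * a)\<close> the left side is that of the equation for \<alpha>.
  Duplication at \<open>1/2 - b\<close> leaves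
  \<open>Gamma (1 - 2 * b) / (Gamma (1 - b))\<^sup>2\<close>, and the functional equation of
  \<open>Gamma\<close> at \<open>1 - 2 * b\<close> brings in \<open>Beta\<close>; the minus sign
  comes from writing \<open>1 - 2 * b\<close> as \<open>- (2 * b - 1)\<close>.\<close>

lemma alpha_lhs_eq:
  fixes b :: real
  assumes "1/2 < b" "b < 1"
  shows "1 / (4 powr b * sqrt pi) * (Gamma (1/2 - b) / Gamma (1 - b)) =
    - 1 / ((2 * b - 1) * Beta (1 - b) (1 - b))"
proof -
  have n1: "1/2 - b \<notin> \<int>\<^sub>\<le>\<^sub>0" "1 - 2 * b \<notin> \<int>\<^sub>\<le>\<^sub>0"
    by (rule notin_nonpos_Ints_between, use assms in simp, use assms in simp)+
  have g: "Gamma (1 - b) > 0" using assms by (intro Gamma_real_pos) auto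
  then have n2: "1/2 - b + 1/2 \<notin> \<int>\<^sub>\<le>\<^sub>0" by (auto simp: Gamma_eq_zero_iff[symmetric])
  have nz: "Gamma (1 - 2 * b) \<noteq> 0" using n1 by (simp add: Gamma_eq_zero_iff)
  have "Gamma (1/2 - b) * Gamma (1/2 - b + 1/2) = exp ((1 - 2 * (1/2 - b)) * ln 2) * sqrt pi * Gamma (2 * (1/2 - b))"
    by (rule Gamma_legendre_duplication_real[OF n1(1) n2])
  moreover have "exp ((1 - 2 * (1/2 - b)) * ln 2) = 4 powr b"
  proof -
    have "ln (4::real) = 2 * ln 2" using ln_realpow[of 2 2] by simp
    then show ?thesis by (simp add: powr_def algebra_simps)
  qed
  ultimately have dup: "Gamma (1/2 - b) * Gamma (1 - b) = 4 powr b * sqrt pi * Gamma (1 - 2 * b)"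
    by (simp add: algebra_simps)
  define w where "w = 1 - 2 * b"
  have w: "w \<noteq> 0" "2 * b - 1 = - w" "1 - b + (1 - b) = w + 1" using assms by (auto simp: w_def)
  have G: "Gamma (w + 1) = w * Gamma w"
    using Gamma_plus1[OF n1(2)] by (simp add: w_def)
  have B: "(2 * b - 1) * Beta (1 - b) (1 - b) = - ((Gamma (1 - b))\<^sup>2 / Gamma (1 - 2 * b))"
    unfolding Beta_def w(2,3) G unfolding w_def[symmetric] using w(1) by (simp add: power2_eq_square)
  have "1 / (4 powr b * sqrt pi) * (Gamma (1/2 - b) / Gamma (1 - b)) =
      (Gamma (1/2 - b) * Gamma (1 - b)) / (4 powr b * sqrt pi * (Gamma (1 - b))\<^sup>2)"
    using g by (simp add: power2_eq_square)
  also have "\<dots> = Gamma (1 - 2 * b) / (Gamma (1 - b))\<^sup>2"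
    unfolding dup using pi_gt_zero by simp
  finally show ?thesis unfolding B using g nz by simp
qed

text \<open>The map from \<open>a\<close> to \<open>1 / (2 * a)\<close> is an involution of the
  interval (1/2, 1), so uniqueness in \<open>b\<close> carries over to \<open>a\<close>.\<close>

lemma alpha_eqI:
  assumes p: "0 < p" "p < 1" and b: "1/2 < b" "b < 1"
    and eq: "(2 * b - 1) * Beta (1 - b) (1 - b) = (1 - p) / p"
  shows "alpha p = 1 / (2 * b)"
  unfolding alpha_def
proof (rule the_equality)
  have *: "- 1 / ((1 - p) / p) = p / (p - 1)" using p by (simp add: field_simps)
  have b': "1 / (2 * (1 / (2 * b))) = b" by simp
  show "1/2 < 1 / (2 * b) \<and> 1 / (2 * b) < 1 \<and>
      1 / (4 powr (1 / (2 * (1 / (2 * b)))) * sqrt pi) *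
      (Gamma (1/2 - 1 / (2 * (1 / (2 * b)))) / Gamma (1 - 1 / (2 * (1 / (2 * b))))) = p / (p - 1)"
    unfolding b' alpha_lhs_eq[OF b] eq * using b by (simp add: field_simps)
  fix a
  assume a: "1/2 < a \<and> a < 1 \<and> 1 / (4 powr (1 / (2 * a)) * sqrt pi) *
      (Gamma (1/2 - 1 / (2 * a)) / Gamma (1 - 1 / (2 * a))) = p / (p - 1)"
  \<comment> \<open>Holds at 0 as well because division by 0 gives 0, so neither side has to be
    shown nonzero.\<close>
  have inj: "u = v" if "- 1 / u = - 1 / v" for u v :: real
    using that by (cases "u = 0"; cases "v = 0") (auto simp: field_simps)
  define y where "y = 1 / (2 * a)"
  have y: "1/2 < y" "y < 1" using a by (auto simp: y_def field_simps)
  have "- 1 / ((2 * y - 1) * Beta (1 - y) (1 - y)) = - 1 / ((1 - p) / p)"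
    using a unfolding y_def[symmetric] alpha_lhs_eq[OF y] * by simp
  then have "(2 * y - 1) * Beta (1 - y) (1 - y) = (1 - p) / p"
    by (rule inj)
  then have "y = b" using Beta_char_inj[OF y b] eq by simp
  moreover have "a = 1 / (2 * y)" using a by (simp add: y_def)
  ultimately show "a = 1 / (2 * b)" by simp
qed

subsection \<open>Slow variation of step functions\<close>

text \<open>Bounding every step by \<open>\<epsilon> / m\<close> is crude, but suffices where
  \<open>n / m\<close> stays bounded.\<close>

lemma increments_le:
  fixes f :: "nat \<Rightarrow> real"
  assumes "1 \<le> m" "m \<le> n"
    and "\<And>i. m \<le> i \<Longrightarrow> \<bar>f (Suc i) - f i\<bar> \<le> \<epsilon> / i" and "\<epsilon> \<ge> 0"
  shows "\<bar>f n - f m\<bar> \<le> \<epsilon> * (real n - m) / m"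
  using assms(2)
proof (induction n rule: dec_induct)
  case (step n)
  have "\<bar>f (Suc n) - f n\<bar> \<le> \<epsilon> / n" using assms(3) step by simp
  also have "\<dots> \<le> \<epsilon> / m" using step assms(1,4) by (intro divide_left_mono) auto
  finally have "\<bar>f (Suc n) - f m\<bar> \<le> \<epsilon> * (real n - m) / m + \<epsilon> / m" using step by linarith
  then show ?case by (simp add: add_divide_distrib[symmetric] algebra_simps)
qed simp

text \<open>Between \<open>z\<close> and \<open>x * z\<close> the step function jumps a number of
  times of order \<open>z\<close>, each time changing the logarithm by o(1/z), so the logarithm of
  the ratio tends to 0. The \<open>max 1\<close> keeps the index in the range where \<open>l\<close>
  is positive.\<close>

lemma slowly_varying_floorI:
  fixes l :: "nat \<Rightarrow> real"
  assumes pos: "\<And>n. n \<ge> 1 \<Longrightarrow> l n > 0"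
    and lim: "(\<lambda>n. n * (ln (l (Suc n)) - ln (l n))) \<longlonglongrightarrow> 0"
  shows "slowly_varying (\<lambda>z. l (nat \<lfloor>max 1 z\<rfloor>))"
  unfolding slowly_varying_def
proof (intro conjI allI impI)
  define \<phi> where "\<phi> z = l (nat \<lfloor>max 1 z\<rfloor>)" for z :: real
  have \<phi>_pos: "\<phi> z > 0" for z unfolding \<phi>_def by (intro pos) (simp add: le_nat_iff le_floor_iff)
  then show "0 < l (nat \<lfloor>max 1 z\<rfloor>)" for z :: real by (simp add: \<phi>_def)
  have "(\<lambda>z::real. l (nat \<lfloor>max 1 z\<rfloor>)) \<in> borel_measurable borel"
    by (rule measurable_compose[where f = "\<lambda>z::real. \<lfloor>max 1 z\<rfloor>" and N = "count_space UNIV" and g = "\<lambda>i. l (nat i)"])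
       measurable
  then show "(\<lambda>z::real. l (nat \<lfloor>max 1 z\<rfloor>)) \<in> borel_measurable (restrict_space borel {0<..})"
    by (rule measurable_restrict_space1)
  fix x :: real assume x: "x > 0"
  \<comment> \<open>The two indices compared below lie between \<open>min 1 x * z / 2\<close> and
    \<open>(1 + x) * z\<close>; \<open>K\<close> is the ratio of these bounds.\<close>
  define K where "K = 2 * (1 + x) / min 1 x"
  have K: "K > 0" using x by (simp add: K_def)
  have "((\<lambda>z. ln (\<phi> (x * z)) - ln (\<phi> z)) \<longlongrightarrow> 0) at_top"
  proof (rule tendstoI)
    fix \<epsilon> :: real assume "\<epsilon> > 0"
    define \<delta> where "\<delta> = \<epsilon> / (2 * K)"
    have \<delta>: "\<delta> > 0" "\<delta> * K < \<epsilon>" using K \<open>\<epsilon> > 0\<close> by (auto simp: \<delta>_def)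
    obtain N where N: "\<And>n. n \<ge> N \<Longrightarrow> \<bar>n * (ln (l (Suc n)) - ln (l n))\<bar> < \<delta>"
      using tendstoD[OF lim \<delta>(1)] by (auto simp: eventually_sequentially dist_real_def)
    define N' where "N' = max 1 N"
    have step: "\<bar>ln (l (Suc n)) - ln (l n)\<bar> \<le> \<delta> / n" if "n \<ge> N'" for n
    proof -
      have "real n * \<bar>ln (l (Suc n)) - ln (l n)\<bar> < \<delta>"
        using N[of n] that by (simp add: N'_def abs_mult)
      then show ?thesis using that by (subst pos_le_divide_eq) (auto simp: N'_def mult.commute)
    qed
    \<comment> \<open>The threshold makes both \<open>z\<close> and \<open>x * z\<close> at least
      \<open>2 * (N' + 1)\<close>, so that their floors are at least \<open>N'\<close> and at least
      half of the arguments.\<close>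
    have bnd: "\<bar>ln (\<phi> (x * z)) - ln (\<phi> z)\<bar> < \<epsilon>" if z: "z \<ge> (real N' + 1) * 2 * (1 + 1 / x)" for z
    proof -
      have "(real N' + 1) * 2 * (1 + 1 / x) \<ge> (real N' + 1) * 2 * 1"
        using x by (intro mult_left_mono) auto
      then have z1: "z \<ge> 2 * (real N' + 1)" using z by linarith
      have "(real N' + 1) * 2 * (1 + 1 / x) \<ge> (real N' + 1) * 2 * (1 / x)"
        using x by (intro mult_left_mono) auto
      then have "z \<ge> (real N' + 1) * 2 * (1 / x)" using z by linarith
      then have z2: "x * z \<ge> 2 * (real N' + 1)" using x by (simp add: field_simps)
      have main: "\<exists>m::nat. \<phi> y = l m \<and> m \<ge> N' \<and> real m \<ge> y / 2 \<and> real m \<le> y" if "y \<ge> 2 * (real N' + 1)" for y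
      proof (intro exI[of _ "nat \<lfloor>max 1 y\<rfloor>"] conjI)
        have y: "y \<ge> 2" using that by simp
        then have f: "real (nat \<lfloor>max 1 y\<rfloor>) = of_int \<lfloor>y\<rfloor>" by (simp add: max_def)
        show "real (nat \<lfloor>max 1 y\<rfloor>) \<ge> y / 2" "real (nat \<lfloor>max 1 y\<rfloor>) \<le> y"
          unfolding f using y by linarith+
        moreover have "real N' \<le> y / 2" using that by simp
        ultimately have "real N' \<le> real (nat \<lfloor>max 1 y\<rfloor>)" by (metis order_trans)
        then show "N' \<le> nat \<lfloor>max 1 y\<rfloor>" by (simp only: of_nat_le_iff)
      qed (simp add: \<phi>_def)
      obtain m where m: "\<phi> z = l m" "m \<ge> N'" "real m \<ge> z / 2" "real m \<le> z" using main[OF z1] by blast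
      obtain n where n: "\<phi> (x * z) = l n" "n \<ge> N'" "real n \<ge> x * z / 2" "real n \<le> x * z" using main[OF z2] by blast
      have z0: "z > 0" using z1 by simp
      have aux: "\<bar>ln (l j) - ln (l i)\<bar> < \<epsilon>"
        if "N' \<le> i" "i \<le> j" "real i \<ge> min 1 x * z / 2" "real j \<le> (1 + x) * z" for i j
      proof -
        have "\<bar>ln (l j) - ln (l i)\<bar> \<le> \<delta> * (real j - i) / i"
          using that \<delta> step by (intro increments_le) (auto simp: N'_def)
        also have "\<dots> \<le> \<delta> * ((1 + x) * z) / (min 1 x * z / 2)"
          using that \<delta> x z0 by (intro frac_le mult_left_mono) auto
        also have "\<dots> = \<delta> * K" using z0 x by (simp add: K_def)
        finally show ?thesis using \<delta> by linarith
      qed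
      have le: "min 1 x * z \<le> z" "min 1 x * z \<le> x * z" "z \<le> (1 + x) * z" "x * z \<le> (1 + x) * z"
        using z0 x mult_right_mono[of "min 1 x" 1 z] mult_right_mono[of "min 1 x" x z]
        by (auto simp: algebra_simps)
      show ?thesis
        unfolding m n
        using aux[of m n] aux[of n m] m n le by (cases "m \<le> n") (auto simp: abs_minus_commute)
    qed
    show "eventually (\<lambda>z. dist (ln (\<phi> (x * z)) - ln (\<phi> z)) 0 < \<epsilon>) at_top"
      using eventually_ge_at_top[of "(real N' + 1) * 2 * (1 + 1 / x)"]
      by eventually_elim (use bnd in \<open>auto simp: dist_real_def\<close>)
  qed
  then have "((\<lambda>z. exp (ln (\<phi> (x * z)) - ln (\<phi> z))) \<longlongrightarrow> exp 0) at_top"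
    by (rule tendsto_exp)
  then show "((\<lambda>z. l (nat \<lfloor>max 1 (x * z)\<rfloor>) / l (nat \<lfloor>max 1 z\<rfloor>)) \<longlongrightarrow> 1) at_top"
    using \<phi>_pos by (simp add: exp_diff \<phi>_def)
qed

text \<open>A factor with a positive limit does not disturb slow variation; with the local exponent
  as \<open>u\<close> this carries the result from \<open>Q\<close> to \<open>q\<close>.\<close>

lemma slowly_varying_floor_mult:
  fixes l u :: "nat \<Rightarrow> real"
  assumes sv: "slowly_varying (\<lambda>z. l (nat \<lfloor>max 1 z\<rfloor>))"
    and pos: "\<And>n. n \<ge> 1 \<Longrightarrow> u n > 0" and lim: "u \<longlonglongrightarrow> a" and "a > 0"
  shows "slowly_varying (\<lambda>z. u (nat \<lfloor>max 1 z\<rfloor>) * l (nat \<lfloor>max 1 z\<rfloor>))"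
  unfolding slowly_varying_def
proof (intro conjI allI impI)
  have upos: "u (nat \<lfloor>max 1 z\<rfloor>) > 0" for z :: real
    by (intro pos) (simp add: le_nat_iff le_floor_iff)
  then show "0 < u (nat \<lfloor>max 1 z\<rfloor>) * l (nat \<lfloor>max 1 z\<rfloor>)" if "z > 0" for z :: real
    using sv that by (simp add: slowly_varying_def)
  have "(\<lambda>z::real. u (nat \<lfloor>max 1 z\<rfloor>) * l (nat \<lfloor>max 1 z\<rfloor>)) \<in> borel_measurable borel"
    by (rule measurable_compose[where f = "\<lambda>z::real. \<lfloor>max 1 z\<rfloor>" and N = "count_space UNIV"
          and g = "\<lambda>i. u (nat i) * l (nat i)"]) measurable
  then show "(\<lambda>z::real. u (nat \<lfloor>max 1 z\<rfloor>) * l (nat \<lfloor>max 1 z\<rfloor>)) \<in> borel_measurable (restrict_space borel {0<..})"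
    by (rule measurable_restrict_space1)
  have "filterlim (\<lambda>z::real. nat \<lfloor>max 1 z\<rfloor>) sequentially at_top"
    unfolding filterlim_at_top
  proof
    fix N :: nat
    show "eventually (\<lambda>z::real. N \<le> nat \<lfloor>max 1 z\<rfloor>) at_top"
      using eventually_ge_at_top[of "real N"]
      by eventually_elim (auto simp: le_nat_iff le_floor_iff max_def)
  qed
  then have ulim: "((\<lambda>z::real. u (nat \<lfloor>max 1 z\<rfloor>)) \<longlongrightarrow> a) at_top"
    by (rule filterlim_compose[OF lim])
  fix x :: real assume x: "x > 0"
  have "filterlim (\<lambda>z. x * z) at_top at_top"
    using x by (intro filterlim_tendsto_pos_mult_at_top[OF tendsto_const _ filterlim_ident])
  then have "((\<lambda>z. u (nat \<lfloor>max 1 (x * z)\<rfloor>)) \<longlongrightarrow> a) at_top"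
    by (rule filterlim_compose[OF ulim])
  then have "((\<lambda>z. u (nat \<lfloor>max 1 (x * z)\<rfloor>) / u (nat \<lfloor>max 1 z\<rfloor>) *
      (l (nat \<lfloor>max 1 (x * z)\<rfloor>) / l (nat \<lfloor>max 1 z\<rfloor>))) \<longlongrightarrow> a / a * 1) at_top"
    using sv x \<open>a > 0\<close> by (intro tendsto_mult tendsto_divide ulim) (auto simp: slowly_varying_def)
  then show "((\<lambda>z. u (nat \<lfloor>max 1 (x * z)\<rfloor>) * l (nat \<lfloor>max 1 (x * z)\<rfloor>) /
      (u (nat \<lfloor>max 1 z\<rfloor>) * l (nat \<lfloor>max 1 z\<rfloor>))) \<longlongrightarrow> 1) at_top"
    using \<open>a > 0\<close> by simp
qed

subsection \<open>Estimates for real sequences\<close>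

lemma sum_flip: "(\<Sum>i=1..<k. f i (k - i)) = (\<Sum>i=1..<k::nat. f (k - i) i)"
  by (rule sum.reindex_bij_witness[of _ "\<lambda>i. k - i" "\<lambda>i. k - i"]) auto

text \<open>Since \<open>ln (1 + 1 / i) \<le> 1 / i\<close>, the factor \<open>1 - b / i\<close> is
  at most \<open>(i / (i + 1)) powr b\<close>, and the product of these powers telescopes.\<close>

lemma powr_prod_bound:
  fixes u :: "nat \<Rightarrow> real"
  assumes "1 \<le> m" "m \<le> n" "b \<ge> 0"
    and nonneg: "\<And>i. m \<le> i \<Longrightarrow> u i \<ge> 0"
    and step: "\<And>i. m \<le> i \<Longrightarrow> u (Suc i) \<le> u i * (1 - b / i)"
  shows "u n \<le> u m * (m / n) powr b"
  using \<open>m \<le> n\<close>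
proof (induction n rule: dec_induct)
  case (step n)
  have n: "n \<ge> 1" using step \<open>1 \<le> m\<close> by simp
  have "ln (real (Suc n) / n) \<le> 1 / n"
    using ln_add_one_self_le_self[of "1 / n"] n by (simp add: field_simps)
  then have "b * ln (real (Suc n) / n) \<le> b / n"
    using \<open>b \<ge> 0\<close> mult_left_mono by fastforce
  then have "1 - b / n \<le> exp (- (b * ln (real (Suc n) / n)))"
    using exp_ge_add_one_self[of "- (b * ln (real (Suc n) / n))"] by linarith
  also have "\<dots> = (n / Suc n) powr b"
    using n by (simp add: powr_def ln_div algebra_simps)
  finally have le: "1 - b / n \<le> (n / Suc n) powr b" .
  have "u (Suc n) \<le> u n * (1 - b / n)" using assms(5) step by simp
  also have "\<dots> \<le> u n * (n / Suc n) powr b"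
    using le nonneg step by (intro mult_left_mono) auto
  also have "\<dots> \<le> u m * (m / n) powr b * (n / Suc n) powr b"
    using step by (intro mult_right_mono) auto
  also have "\<dots> = u m * ((m / n) * (n / Suc n)) powr b"
    using n \<open>1 \<le> m\<close> by (simp add: powr_mult[symmetric])
  also have "(m / n) * (n / Suc n) = m / Suc n"
    using n by simp
  finally show ?case .
qed (use \<open>1 \<le> m\<close> in simp)

lemma sum_inverse_sqrt_le: "(\<Sum>j=1..n. 1 / sqrt (real j)) \<le> 2 * sqrt n"
proof (induction n)
  case (Suc n)
  have "(sqrt (Suc n) - sqrt n) * (sqrt (Suc n) + sqrt n) = 1"
    by (simp add: algebra_simps)
  moreover have "(sqrt (Suc n) - sqrt n) * (sqrt (Suc n) + sqrt n) \<le> (sqrt (Suc n) - sqrt n) * (2 * sqrt (Suc n))"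
    by (intro mult_left_mono) auto
  ultimately have "1 \<le> 2 * (sqrt (Suc n) - sqrt n) * sqrt (Suc n)"
    by linarith
  then have "1 / sqrt (Suc n) \<le> 2 * (sqrt (Suc n) - sqrt n)"
    by (subst pos_divide_le_eq) auto
  then show ?case using Suc by simp
qed simp

text \<open>The harmonic number of index \<open>k - 1\<close>, serving as the penalty: unbounded,
  but growing by at most \<open>(k - i) / i\<close> between \<open>i\<close> and
  \<open>k\<close>.\<close>

definition harm_below :: "nat \<Rightarrow> real" where "harm_below k = (\<Sum>j=1..<k. 1 / real j)"

lemma harm_below_Suc: "k \<ge> 1 \<Longrightarrow> harm_below (Suc k) = harm_below k + 1 / k"
  by (simp add: harm_below_def)

lemma harm_below_mono: "i \<le> k \<Longrightarrow> harm_below i \<le> harm_below k"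
  unfolding harm_below_def by (intro sum_mono2) auto

lemma harm_below_diff_le:
  assumes "1 \<le> i" "i \<le> k" shows "harm_below k - harm_below i \<le> (real k - i) / i"
  using assms(2)
proof (induction k rule: dec_induct)
  case (step n)
  have "1 / real n \<le> 1 / real i" using step assms(1) by (intro divide_left_mono) auto
  then have "harm_below (Suc n) - harm_below i \<le> (real n - i) / i + 1 / i"
    using harm_below_Suc[of n] step assms(1) by simp
  then show ?case by (simp add: add_divide_distrib diff_divide_distrib)
qed simp

lemma harm_below_at_top: "filterlim harm_below at_top sequentially"
proof -
  have "harm_below (Suc n) = harm n" for n
    unfolding harm_below_def harm_def by (simp add: atLeastLessThanSuc_atLeastAtMost inverse_eq_divide)
  then have "filterlim (\<lambda>n. harm_below (Suc n)) at_top sequentially"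
    using harm_at_top by simp
  then show ?thesis by (simp add: filterlim_sequentially_Suc)
qed

text \<open>The difference is the sum of \<open>1 / j\<close> over \<open>i \<le> j < k\<close>, so
  both sides are the same double sum.\<close>

lemma sum_harm_below_diff: "(\<Sum>i=1..<k. (harm_below k - harm_below i) * f i) = (\<Sum>j=1..<k. (\<Sum>i=1..j. f i) / j)"
proof (induction k)
  case (Suc k)
  show ?case
  proof (cases "k = 0")
    case False
    have "(\<Sum>i=1..<Suc k. (harm_below (Suc k) - harm_below i) * f i) =
        (\<Sum>i=1..<Suc k. (harm_below k - harm_below i) * f i) + (\<Sum>i=1..<Suc k. f i) / k"
      using harm_below_Suc[of k] False
      by (simp add: sum.distrib[symmetric] sum_divide_distrib algebra_simps add_divide_distrib)
    also have "(\<Sum>i=1..<Suc k. (harm_below k - harm_below i) * f i) = (\<Sum>i=1..<k. (harm_below k - harm_below i) * f i)"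
      using False by simp
    also have "(\<Sum>i=1..<Suc k. f i) = (\<Sum>i=1..k. f i)"
      by (simp add: atLeastLessThanSuc_atLeastAtMost)
    finally show ?thesis
      using Suc False by simp
  qed simp
qed simp

text \<open>The penalty makes the maximiser beat all earlier indices almost exactly, so that a maximum
  principle applies to it.\<close>

lemma penalised_maximiser:
  fixes g h :: "nat \<Rightarrow> real"
  assumes bound: "\<And>k. 1 \<le> k \<Longrightarrow> \<bar>g k\<bar> \<le> B"
    and mono: "\<And>i j. i \<le> j \<Longrightarrow> h i \<le> h j"
    and top: "filterlim h at_top sequentially"
    and "\<eta> > 0"
    and freq: "\<And>N. \<exists>k\<ge>N. g k > L"
  shows "\<exists>k\<ge>N. g k > L \<and> (\<forall>i. 1 \<le> i \<and> i < k \<longrightarrow> g i \<le> g k + \<eta> * (h k - h i))"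
proof -
  define N1 where "N1 = max 1 N"
  obtain N2 where N2: "\<And>k. k \<ge> N2 \<Longrightarrow> h k > h N1 + 2 * B / \<eta>"
    using top unfolding filterlim_at_top_dense eventually_sequentially by blast
  obtain k0 where k0: "k0 \<ge> max N1 N2" "g k0 > L" using freq by blast
  obtain K where K: "\<And>k. k \<ge> K \<Longrightarrow> h k > h k0 + 2 * B / \<eta>"
    using top unfolding filterlim_at_top_dense eventually_sequentially by blast
  \<comment> \<open>The penalty is centred at \<open>k0\<close>, so \<open>f k0 = g k0\<close>. An
    index whose value of \<open>h\<close> is further than \<open>2 * B / \<eta>\<close> from
    \<open>h k0\<close> loses more than \<open>g\<close> can vary, so a maximum over the finite
    window \<open>{N1..K'}\<close> is one over all indices from 1 on.\<close>
  define f where "f i = g i - \<eta> * \<bar>h i - h k0\<bar>" for i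
  define K' where "K' = max K k0"
  have "\<exists>k\<in>{N1..K'}. \<forall>i\<in>{N1..K'}. f i \<le> f k"
  proof -
    have "Max (f ` {N1..K'}) \<in> f ` {N1..K'}"
      using k0 by (intro Max_in) (auto simp: K'_def)
    then obtain k where "k \<in> {N1..K'}" "f k = Max (f ` {N1..K'})" by auto
    then show ?thesis by (intro bexI[of _ k]) auto
  qed
  then obtain k where k: "k \<in> {N1..K'}" and kmax: "\<And>i. i \<in> {N1..K'} \<Longrightarrow> f i \<le> f k" by blast
  have fk0: "f k0 = g k0" by (simp add: f_def)
  have k0k: "f k0 \<le> f k" using k0 by (intro kmax) (auto simp: K'_def)
  have far: "f i \<le> f k0" if "1 \<le> i" "\<bar>h i - h k0\<bar> > 2 * B / \<eta>" for i
  proof -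
    have "\<eta> * \<bar>h i - h k0\<bar> > 2 * B"
      using that(2) \<open>\<eta> > 0\<close> by (simp add: field_simps)
    moreover have "\<bar>g i\<bar> \<le> B" "\<bar>g k0\<bar> \<le> B" using bound that k0 by (auto simp: N1_def)
    ultimately show ?thesis unfolding fk0 by (simp add: f_def)
  qed
  have "f i \<le> f k" if i: "1 \<le> i" for i
  proof -
    consider "i < N1" | "i \<in> {N1..K'}" | "i > K'" by force
    then show ?thesis
    proof cases
      case 1
      then have "h i \<le> h N1" using mono by simp
      moreover have "h k0 > h N1 + 2 * B / \<eta>" using N2 k0 by simp
      ultimately have "\<bar>h i - h k0\<bar> > 2 * B / \<eta>" by linarith
      then show ?thesis using far[OF i] k0k by linarith
    next
      case 3
      then have "h i > h k0 + 2 * B / \<eta>" using K by (simp add: K'_def)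
      then have "\<bar>h i - h k0\<bar> > 2 * B / \<eta>" by linarith
      then show ?thesis using far[OF i] k0k by linarith
    qed (rule kmax)
  qed
  note all = this
  have "g i \<le> g k + \<eta> * (h k - h i)" if "1 \<le> i" "i < k" for i
  proof -
    have "g i \<le> g k + (\<eta> * \<bar>h i - h k0\<bar> - \<eta> * \<bar>h k - h k0\<bar>)"
      using all[OF that(1)] by (simp add: f_def)
    also have "\<eta> * \<bar>h i - h k0\<bar> - \<eta> * \<bar>h k - h k0\<bar> \<le> \<eta> * (h k - h i)"
      unfolding right_diff_distrib[symmetric]
      using mono[of i k] that \<open>\<eta> > 0\<close> by (intro mult_left_mono) auto
    finally show ?thesis by simp
  qed
  moreover have "g k > L"
  proof -
    have "g k0 \<le> g k - \<eta> * \<bar>h k - h k0\<bar>" using k0k fk0 by (simp add: f_def)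
    moreover have "\<eta> * \<bar>h k - h k0\<bar> \<ge> 0" using \<open>\<eta> > 0\<close> by simp
    ultimately show ?thesis using k0 by linarith
  qed
  moreover have "k \<ge> N" using k by (simp add: N1_def)
  ultimately show ?thesis by blast
qed

text \<open>\<open>L\<close> is the limit superior, obtained as the infimum of the eventual upper
  bounds and delivered through its two characteristic inequalities.\<close>

lemma bounded_limsup:
  fixes g :: "nat \<Rightarrow> real"
  assumes bound: "\<And>k. 1 \<le> k \<Longrightarrow> \<bar>g k\<bar> \<le> B"
  obtains L where "\<And>\<eta>. \<eta> > 0 \<Longrightarrow> eventually (\<lambda>k. g k < L + \<eta>) sequentially"
    and "\<And>\<eta> N. \<eta> > 0 \<Longrightarrow> \<exists>k\<ge>N. g k > L - \<eta>"
proof -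
  define U where "U = {s. eventually (\<lambda>k. g k \<le> s) sequentially}"
  define L where "L = Inf U"
  have ne: "B \<in> U"
    unfolding U_def eventually_sequentially using bound by (auto intro!: exI[of _ 1] simp: abs_le_iff)
  have bdd: "bdd_below U"
  proof (rule bdd_belowI)
    fix s assume "s \<in> U"
    then obtain N where "\<And>k. k \<ge> N \<Longrightarrow> g k \<le> s" by (auto simp: U_def eventually_sequentially)
    then have "g (max 1 N) \<le> s" by simp
    moreover have "\<bar>g (max 1 N)\<bar> \<le> B" by (rule bound) simp
    ultimately show "- B \<le> s" by linarith
  qed
  show ?thesis
  proof
    fix \<eta> :: real assume "\<eta> > 0"
    then obtain s where s: "s \<in> U" "s < L + \<eta>"
      using cInf_lessD[of U "L + \<eta>"] ne by (auto simp: L_def)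
    then have "eventually (\<lambda>k. g k \<le> s) sequentially" by (simp add: U_def)
    then show "eventually (\<lambda>k. g k < L + \<eta>) sequentially"
      by eventually_elim (use s in linarith)
  next
    fix \<eta> :: real and N :: nat assume "\<eta> > 0"
    show "\<exists>k\<ge>N. g k > L - \<eta>"
    proof (rule ccontr)
      assume "\<not> ?thesis"
      then have "L - \<eta> \<in> U"
        unfolding U_def eventually_sequentially by (force simp: not_less)
      then have "L \<le> L - \<eta>" unfolding L_def using bdd by (rule cInf_lower)
      with \<open>\<eta> > 0\<close> show False by simp
    qed
  qed
qed

text \<open>The cells numbered 1 to \<open>k\<close> tile the interval (0, 1], and \<open>x\<close>
  lies in cell \<open>nat \<lceil>x * k\<rceil>\<close>. Cell \<open>k\<close> is absent from the
  sum, whence the value 0.\<close>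

lemma sum_indicator_cell:
  fixes k :: nat and x :: real
  assumes "k > 0" "0 < x" "x < 1"
  shows "(\<Sum>i=1..<k. F i * indicator {(real i - 1) / k<..i / k} x) =
    (if nat \<lceil>x * k\<rceil> < k then F (nat \<lceil>x * k\<rceil>) else (0::real))"
proof -
  have iff: "x \<in> {(real i - 1) / k<..i / k} \<longleftrightarrow> i = nat \<lceil>x * k\<rceil>" if "i \<ge> 1" for i :: nat
  proof -
    have "x \<in> {(real i - 1) / k<..i / k} \<longleftrightarrow> real i - 1 < x * k \<and> x * k \<le> real i"
      using assms by (auto simp: field_simps)
    also have "\<dots> \<longleftrightarrow> \<lceil>x * k\<rceil> = int i" by (auto simp: ceiling_eq_iff)
    also have "\<dots> \<longleftrightarrow> i = nat \<lceil>x * k\<rceil>" using that by auto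
    finally show ?thesis .
  qed
  have "x * k > 0" using assms by simp
  then have "nat \<lceil>x * k\<rceil> \<ge> 1" by linarith
  moreover have "(\<Sum>i=1..<k. F i * indicator {(real i - 1) / k<..i / k} x) =
      (\<Sum>i=1..<k. if i = nat \<lceil>x * k\<rceil> then F i else 0)"
    by (intro sum.cong refl) (use iff in \<open>auto simp: indicator_def\<close>)
  ultimately show ?thesis by simp
qed

text \<open>First \<rho> is fixed to make one term small, then \<open>n\<close> is sent to infinity;
  \<open>K'\<close> may depend on \<rho>.\<close>

lemma tendsto_0_tradeoff:
  fixes a b :: "nat \<Rightarrow> real"
  assumes "b \<longlonglongrightarrow> 0" "d > 0" "K \<ge> 0" "\<And>n. a n \<ge> 0"
    and bound: "\<And>\<rho>. 0 < \<rho> \<Longrightarrow> \<rho> < 1/2 \<Longrightarrow> \<exists>K'. eventually (\<lambda>n. a n \<le> K * \<rho> powr d + K' * b n) sequentially"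
  shows "a \<longlonglongrightarrow> 0"
proof (rule tendstoI)
  fix \<epsilon> :: real assume "\<epsilon> > 0"
  \<comment> \<open>Makes \<open>K * \<rho> powr d\<close> at most \<open>\<epsilon> / 2\<close>;
    the \<open>K + 1\<close> covers \<open>K = 0\<close>, and 1/4 keeps \<rho> below 1/2.\<close>
  define \<rho> where "\<rho> = min (1/4) ((\<epsilon> / (2 * (K + 1))) powr (1 / d))"
  have \<rho>: "0 < \<rho>" "\<rho> < 1/2" using \<open>\<epsilon> > 0\<close> \<open>K \<ge> 0\<close> by (auto simp: \<rho>_def)
  have "\<rho> powr d \<le> ((\<epsilon> / (2 * (K + 1))) powr (1 / d)) powr d"
    using \<rho> \<open>d > 0\<close> by (intro powr_mono2) (auto simp: \<rho>_def)
  also have "\<dots> = \<epsilon> / (2 * (K + 1))"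
    using \<open>d > 0\<close> \<open>\<epsilon> > 0\<close> \<open>K \<ge> 0\<close> by (simp add: powr_powr)
  finally have "K * \<rho> powr d \<le> K * (\<epsilon> / (2 * (K + 1)))" using \<open>K \<ge> 0\<close> by (intro mult_left_mono)
  also have "\<dots> \<le> \<epsilon> / 2" using \<open>K \<ge> 0\<close> \<open>\<epsilon> > 0\<close> by (simp add: field_simps)
  finally have 1: "K * \<rho> powr d \<le> \<epsilon> / 2" .
  obtain K' where K': "eventually (\<lambda>n. a n \<le> K * \<rho> powr d + K' * b n) sequentially"
    using bound[OF \<rho>] by blast
  have "(\<lambda>n. K' * b n) \<longlonglongrightarrow> 0" using assms(1) by (rule tendsto_mult_right_zero)
  then have "eventually (\<lambda>n. K' * b n < \<epsilon> / 2) sequentially"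
    using \<open>\<epsilon> > 0\<close> by (intro order_tendstoD) auto
  with K' show "eventually (\<lambda>n. dist (a n) 0 < \<epsilon>) sequentially"
    by eventually_elim (use 1 assms(4) in \<open>auto simp: dist_real_def\<close>)
qed

subsection \<open>The recursion for the tail\<close>

text \<open>All that the asymptotic analysis uses about the trees. The strict bound
  \<open>q 1 > 1/2\<close> is what will keep the local exponent away from 1/2.\<close>

locale lis_tail =
  fixes q Q :: "nat \<Rightarrow> real" and \<theta> :: real
  assumes theta_pos: "\<theta> > 0"
    and Q_1: "Q 1 = 1"
    and Q_Suc: "k \<ge> 1 \<Longrightarrow> Q (Suc k) = Q k - q k"
    and Q_nonneg: "Q k \<ge> 0"
    and q_1: "q 1 > 1/2"
    and q_1_eq: "q 1 = Q 2 + \<theta> * (Q 2)\<^sup>2"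
    and conv_qq: "k \<ge> 2 \<Longrightarrow> (\<Sum>i=1..<k. q i * q (k - i)) = q k * (2 + \<theta> * (Q k + Q (Suc k)))"
begin

lemma q_pos: "k \<ge> 1 \<Longrightarrow> q k > 0"
proof (induction k rule: less_induct)
  case (less k)
  show ?case
  proof (cases "k = 1")
    case False
    with less have k: "k \<ge> 2" by simp
    have pos: "q i > 0" if "1 \<le> i" "i < k" for i using less that by auto
    have "0 < (\<Sum>i=1..<k. q i * q (k - i))"
      using k pos by (intro sum_pos) auto
    also have "\<dots> = q k * (2 + \<theta> * (Q k + Q (Suc k)))" by (rule conv_qq[OF k])
    finally have "0 < q k * (2 + \<theta> * (Q k + Q (Suc k)))" .
    moreover have "2 + \<theta> * (Q k + Q (Suc k)) > 0"
      using theta_pos Q_nonneg[of k] Q_nonneg[of "Suc k"] by (simp add: add_pos_nonneg)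
    ultimately show ?thesis by (simp add: zero_less_mult_iff)
  qed (use q_1 in simp)
qed

lemma Q_pos: "k \<ge> 1 \<Longrightarrow> Q k > 0"
  using q_pos[of k] Q_Suc[of k] Q_nonneg[of "Suc k"] by linarith

lemma Q_antimono: assumes "1 \<le> i" "i \<le> j" shows "Q j \<le> Q i"
  using assms(2)
proof (induction j rule: dec_induct)
  case (step n)
  then show ?case using Q_Suc[of n] q_pos[of n] assms(1) by linarith
qed simp

lemma weight_nonneg: "1 \<le> i \<Longrightarrow> i < k \<Longrightarrow> 0 \<le> Q i * q (k - i)"
  using Q_nonneg[of i] q_pos[of "k - i"] by (simp add: less_imp_le)

text \<open>A first summation of \<open>conv_qq\<close>: as \<open>q k = Q k - Q (Suc k)\<close>,
  the product \<open>q k * (Q k + Q (Suc k))\<close> is a difference of squares and telescopes. The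
  start \<open>k = 2\<close> is \<open>q_1_eq\<close>.\<close>

lemma conv_Qq:
  assumes "k \<ge> 2"
  shows "(\<Sum>i=1..<k. Q i * q (k - i)) = Q k + \<theta> * (Q k)\<^sup>2"
proof -
  have "(\<Sum>i=1..<k. q i * Q (k - i)) = Q k + \<theta> * (Q k)\<^sup>2"
    using assms
  proof (induction k rule: dec_induct)
    case base
    then show ?case using q_1_eq Q_1 by (simp add: numeral_2_eq_2)
  next
    case (step k)
    have Qs: "Q (Suc k) = Q k - q k" using step by (simp add: Q_Suc)
    have "(\<Sum>i=1..<Suc k. q i * Q (Suc k - i)) = (\<Sum>i=1..<k. q i * Q (Suc k - i)) + q k"
      using step Q_1 by simp
    also have "(\<Sum>i=1..<k. q i * Q (Suc k - i)) = (\<Sum>i=1..<k. q i * Q (k - i) - q i * q (k - i))"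
      by (intro sum.cong) (auto simp: Suc_diff_le Q_Suc algebra_simps)
    also have "\<dots> = (\<Sum>i=1..<k. q i * Q (k - i)) - q k * (2 + \<theta> * (Q k + Q (Suc k)))"
      using conv_qq[of k] step by (simp add: sum_subtractf)
    also have "\<dots> = Q k + \<theta> * (Q k)\<^sup>2 - q k * (2 + \<theta> * (Q k + Q (Suc k)))"
      using step by simp
    finally show ?case
      unfolding Qs by (simp add: power2_eq_square algebra_simps)
  qed
  then show ?thesis
    using sum_flip[of "\<lambda>i j. q i * Q j" k] by (simp add: mult.commute)
qed

definition c where "c k = (\<Sum>j=1..k. Q j * Q (Suc k - j))"

text \<open>A second summation. Once \<open>c\<close> is known to tend to 0, this makes
  \<open>c k\<close> equal to \<theta> times the sum of \<open>(Q j)\<^sup>2\<close> over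
  \<open>j > k\<close>.\<close>

lemma c_Suc: assumes "k \<ge> 1" shows "c k - c (Suc k) = \<theta> * (Q (Suc k))\<^sup>2"
proof -
  have "c (Suc k) = (\<Sum>j=1..k. Q j * Q (Suc (Suc k) - j)) + Q (Suc k)"
    using Q_1 by (simp add: c_def)
  also have "(\<Sum>j=1..k. Q j * Q (Suc (Suc k) - j)) = (\<Sum>j=1..k. Q j * Q (Suc k - j) - Q j * q (Suc k - j))"
    by (intro sum.cong) (auto simp: Suc_diff_le Q_Suc algebra_simps)
  also have "\<dots> = c k - (\<Sum>j=1..<Suc k. Q j * q (Suc k - j))"
    by (simp add: sum_subtractf c_def atLeastLessThanSuc_atLeastAtMost)
  also have "\<dots> = c k - (Q (Suc k) + \<theta> * (Q (Suc k))\<^sup>2)"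
    using conv_Qq[of "Suc k"] assms by simp
  finally show ?thesis by simp
qed

section \<open>The local exponent and its uniform bounds\<close>

definition e where "e k = k * q k / Q k"

lemma eQ: "k \<ge> 1 \<Longrightarrow> e k * Q k = k * q k"
  using Q_pos[of k] by (simp add: e_def)

lemma q_eq: "k \<ge> 1 \<Longrightarrow> q k = e k * Q k / k"
  by (simp add: eQ)

text \<open>Here \<open>e i * Q i = i * q i\<close>, and exchanging \<open>i\<close> with
  \<open>k - i\<close> replaces the factor \<open>i\<close> by its mean \<open>k / 2\<close>, which
  leaves \<open>conv_qq\<close>.\<close>

lemma conv_weighted:
  assumes "k \<ge> 2"
  shows "(\<Sum>i=1..<k. e i * (Q i * q (k - i))) = e k * Q k * (1 + \<theta> * (Q k + Q (Suc k)) / 2)"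
proof -
  have "(\<Sum>i=1..<k. e i * (Q i * q (k - i))) = (\<Sum>i=1..<k. i * (q i * q (k - i)))"
    by (intro sum.cong refl) (simp add: eQ mult.assoc[symmetric])
  moreover have "(\<Sum>i=1..<k. i * (q i * q (k - i))) = (\<Sum>i=1..<k. real (k - i) * (q i * q (k - i)))"
    using sum_flip[of "\<lambda>i j. i * (q i * q j)" k] by (simp add: mult.commute)
  moreover have "(\<Sum>i=1..<k. i * (q i * q (k - i))) + (\<Sum>i=1..<k. real (k - i) * (q i * q (k - i)))
      = (\<Sum>i=1..<k. k * (q i * q (k - i)))"
    unfolding sum.distrib[symmetric] by (intro sum.cong refl) (auto simp: of_nat_diff algebra_simps)
  ultimately have "2 * (\<Sum>i=1..<k. e i * (Q i * q (k - i))) = k * (\<Sum>i=1..<k. q i * q (k - i))"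
    by (simp add: sum_distrib_left)
  also have "\<dots> = e k * Q k * (2 + \<theta> * (Q k + Q (Suc k)))"
    using conv_qq[OF assms] eQ[of k] assms by (simp add: algebra_simps)
  finally show ?thesis by (simp add: field_simps)
qed

text \<open>\<open>conv_Qq\<close> gives the total weight and \<open>conv_weighted\<close> the
  weighted sum; they cancel up to a positive error with the small factor \<open>q k\<close>.\<close>

lemma averaging:
  assumes "k \<ge> 2"
  shows "(\<Sum>i=1..<k. (e k - e i) * (Q i * q (k - i))) = \<theta> / 2 * e k * Q k * q k"
proof -
  have "(\<Sum>i=1..<k. (e k - e i) * (Q i * q (k - i))) =
      e k * (\<Sum>i=1..<k. Q i * q (k - i)) - (\<Sum>i=1..<k. e i * (Q i * q (k - i)))"
    by (simp add: left_diff_distrib sum_subtractf sum_distrib_left)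
  also have "\<dots> = e k * (Q k + \<theta> * (Q k)\<^sup>2) - e k * Q k * (1 + \<theta> * (Q k + Q (Suc k)) / 2)"
    by (simp only: conv_Qq[OF assms] conv_weighted[OF assms])
  also have "Q (Suc k) = Q k - q k"
    using assms by (simp add: Q_Suc)
  finally show ?thesis by (simp add: power2_eq_square field_simps)
qed

text \<open>Induction on the weighted mean: since \<open>Q (Suc k) \<le> Q k\<close>, the error only
  raises \<open>e k\<close>, so the initial value \<open>e 1 = q 1\<close> stays a lower
  bound.\<close>

lemma e_ge: "k \<ge> 1 \<Longrightarrow> e k \<ge> q 1"
proof (induction k rule: less_induct)
  case (less k)
  show ?case
  proof (cases "k = 1")
    case True
    then show ?thesis using Q_1 by (simp add: e_def)
  next
    case False
    with less have k: "k \<ge> 2" by simp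
    have Qk: "Q k > 0" "Q (Suc k) \<ge> 0" "Q (Suc k) \<le> Q k"
      using Q_pos[of k] Q_nonneg Q_antimono[of k "Suc k"] k by auto
    define x where "x = 1 + \<theta> * (Q k + Q (Suc k)) / 2"
    have x: "x > 0" unfolding x_def using Qk theta_pos by (simp add: add_pos_nonneg)
    have "q 1 * (Q k * x) \<le> q 1 * (Q k + \<theta> * (Q k)\<^sup>2)"
      using Qk theta_pos q_1 unfolding x_def by (simp add: power2_eq_square algebra_simps)
    also have "\<dots> = (\<Sum>i=1..<k. q 1 * (Q i * q (k - i)))"
      by (simp only: conv_Qq[OF k, symmetric] sum_distrib_left)
    also have "\<dots> \<le> (\<Sum>i=1..<k. e i * (Q i * q (k - i)))"
    proof (intro sum_mono mult_right_mono)
      fix i assume "i \<in> {1..<k}"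
      then show "q 1 \<le> e i" "0 \<le> Q i * q (k - i)"
        using less weight_nonneg[of i k] by auto
    qed
    also have "\<dots> = e k * (Q k * x)"
      by (simp only: conv_weighted[OF k] x_def mult.assoc)
    finally show ?thesis using x Qk by simp
  qed
qed

lemma e_pos: "k \<ge> 1 \<Longrightarrow> e k > 0"
  using e_ge[of k] q_1 by linarith

text \<open>Chosen so that \<open>e_le_aux\<close> is an equality at \<open>k = 1\<close>.\<close>

definition M where "M = q 1 * (1 + \<theta> * Q 2)"

lemma M_pos: "M > 0"
  unfolding M_def using q_1 theta_pos Q_nonneg[of 2] by (intro mult_pos_pos) (auto simp: add_pos_nonneg)

text \<open>For an upper bound the error has the wrong sign and a constant is not inductive. The
  denominator repairs this: the earlier bounds, weakened to \<open>M / (1 + \<theta> * Q k)\<close>,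
  have weighted sum exactly \<open>M * Q k\<close>, and the remaining factor \<open>x\<close> is at
  least \<open>1 + \<theta> * Q (Suc k)\<close>.\<close>

lemma e_le_aux: "k \<ge> 1 \<Longrightarrow> e k \<le> M / (1 + \<theta> * Q (Suc k))"
proof (induction k rule: less_induct)
  case (less k)
  have den: "1 + \<theta> * Q j > 0" for j using theta_pos Q_nonneg[of j] by (simp add: add_pos_nonneg)
  show ?case
  proof (cases "k = 1")
    case True
    then show ?thesis using Q_1 den[of 2] by (simp add: e_def M_def numeral_2_eq_2)
  next
    case False
    with less have k: "k \<ge> 2" by simp
    have Qk: "Q k > 0" "Q (Suc k) \<ge> 0" "Q (Suc k) \<le> Q k"
      using Q_pos[of k] Q_nonneg Q_antimono[of k "Suc k"] k by auto
    define x where "x = 1 + \<theta> * (Q k + Q (Suc k)) / 2"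
    have x: "x \<ge> 1 + \<theta> * Q (Suc k)" unfolding x_def using Qk theta_pos by (simp add: field_simps)
    have "e k * (Q k * x) = (\<Sum>i=1..<k. e i * (Q i * q (k - i)))"
      by (simp only: conv_weighted[OF k] x_def mult.assoc)
    also have "\<dots> \<le> (\<Sum>i=1..<k. M / (1 + \<theta> * Q k) * (Q i * q (k - i)))"
    proof (intro sum_mono mult_right_mono)
      fix i assume i: "i \<in> {1..<k}"
      have "e i \<le> M / (1 + \<theta> * Q (Suc i))" using less i by auto
      also have "\<dots> \<le> M / (1 + \<theta> * Q k)"
        using i M_pos den theta_pos Q_antimono[of "Suc i" k] by (intro divide_left_mono) auto
      finally show "e i \<le> M / (1 + \<theta> * Q k)" .
      show "0 \<le> Q i * q (k - i)"
        using i weight_nonneg[of i k] by auto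
    qed
    also have "\<dots> = M / (1 + \<theta> * Q k) * (Q k * (1 + \<theta> * Q k))"
      by (simp only: conv_Qq[OF k] sum_distrib_left[symmetric]) (simp add: power2_eq_square algebra_simps)
    also have "\<dots> = M * Q k" using den[of k] by simp
    finally have "e k * x \<le> M" using Qk by (simp add: mult.commute mult.left_commute)
    moreover have "e k * (1 + \<theta> * Q (Suc k)) \<le> e k * x"
      using x e_pos[of k] k by (intro mult_left_mono) auto
    ultimately show ?thesis using den[of "Suc k"] by (simp add: pos_le_divide_eq)
  qed
qed

lemma e_le: assumes "k \<ge> 1" shows "e k \<le> M"
proof -
  have "1 + \<theta> * Q (Suc k) \<ge> 1" using theta_pos Q_nonneg[of "Suc k"] by simp
  then have "M / (1 + \<theta> * Q (Suc k)) \<le> M / 1"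
    using M_pos by (intro divide_left_mono) auto
  then show ?thesis using e_le_aux[OF assms] by simp
qed

lemma q_le: "k \<ge> 1 \<Longrightarrow> q k \<le> M * Q k / k"
  using e_le[of k] Q_pos[of k] by (simp add: q_eq divide_right_mono)

lemma q_ge: "k \<ge> 1 \<Longrightarrow> q k \<ge> q 1 * Q k / k"
  using e_ge[of k] Q_pos[of k] by (simp add: q_eq divide_right_mono)

lemma Q_ratio: "i \<ge> 1 \<Longrightarrow> Q (Suc i) = Q i * (1 - e i / i)"
  by (simp add: Q_Suc q_eq algebra_simps)

section \<open>Comparison bounds for \<open>Q\<close>, its partial sums and its
  self-convolution\<close>

text \<open>Follows from \<open>k * q k \<ge> q 1 * Q k\<close>. As \<open>q 1 > 1/2\<close>, the
  decrease of \<open>k * (Q k)\<^sup>2\<close> controls the decrease of \<open>c\<close>, which is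
  of the same form.\<close>

lemma tail_square_decrement:
  assumes "k \<ge> 1"
  shows "(2 * q 1 - 1) * (Q (Suc k))\<^sup>2 \<le> k * (Q k)\<^sup>2 - Suc k * (Q (Suc k))\<^sup>2"
proof -
  define x where "x = Q (Suc k)"
  have x: "x \<ge> 0" "Q k = x + q k" "x \<le> Q k"
    using Q_nonneg[of "Suc k"] Q_Suc[OF assms] q_pos[OF assms] by (auto simp: x_def)
  have "q 1 * x \<le> q 1 * Q k" using x q_1 by (intro mult_left_mono) auto
  also have "\<dots> \<le> k * q k"
    using q_ge[OF assms] assms by (simp add: field_simps)
  finally have "2 * x * (q 1 * x) \<le> 2 * x * (k * q k)" using x by (intro mult_left_mono) auto
  moreover have "k * (Q k)\<^sup>2 \<ge> k * (x\<^sup>2 + 2 * x * q k)"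
    unfolding x(2) by (intro mult_left_mono) (auto simp: power2_eq_square algebra_simps)
  ultimately show ?thesis
    unfolding x_def[symmetric] by (simp add: power2_eq_square algebra_simps)
qed

text \<open>Large enough for \<open>\<theta> \<le> C * (2 * q 1 - 1)\<close>; being at least 1, it
  puts the exponent \<open>1 / C - 1\<close> into (-1, 0].\<close>

definition C where "C = max 1 (\<theta> / (2 * q 1 - 1))"

lemma C_ge_1: "C \<ge> 1" by (simp add: C_def)

text \<open>Each decrease of \<open>c\<close> is at most \<open>C\<close> times that of
  \<open>k * (Q k)\<^sup>2\<close>, so the difference is nondecreasing.\<close>

lemma c_increments:
  assumes "1 \<le> k" "k \<le> n"
  shows "c k - C * (k * (Q k)\<^sup>2) \<le> c n - C * (n * (Q n)\<^sup>2)"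
  using assms(2)
proof (induction n rule: dec_induct)
  case (step n)
  have n: "n \<ge> 1" using step assms by simp
  have "\<theta> * (Q (Suc n))\<^sup>2 \<le> C * ((2 * q 1 - 1) * (Q (Suc n))\<^sup>2)"
  proof -
    have "\<theta> / (2 * q 1 - 1) \<le> C" by (simp add: C_def)
    then have "\<theta> \<le> C * (2 * q 1 - 1)" using q_1 by (simp add: pos_divide_le_eq)
    then show ?thesis by (simp add: mult_right_mono mult.assoc[symmetric])
  qed
  also have "\<dots> \<le> C * (n * (Q n)\<^sup>2 - Suc n * (Q (Suc n))\<^sup>2)"
    using tail_square_decrement[OF n] C_ge_1 by (intro mult_left_mono) auto
  finally show ?case
    using step c_Suc[OF n] by (simp add: right_diff_distrib)
qed simp

lemma Q_le_powr: assumes "n \<ge> 1" shows "Q n \<le> (1 / n) powr q 1"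
proof -
  have "Q n \<le> Q 1 * (real 1 / n) powr q 1"
  proof (rule powr_prod_bound)
    fix i :: nat assume i: "1 \<le> i"
    show "Q (Suc i) \<le> Q i * (1 - q 1 / i)"
      unfolding Q_ratio[OF i] using e_ge[OF i] Q_nonneg by (intro mult_left_mono) (auto simp: divide_right_mono)
  qed (use assms q_1 Q_nonneg in auto)
  then show ?thesis using Q_1 by simp
qed

text \<open>In each product one index is at least \<open>n / 2\<close>, so that factor is at most
  \<open>y\<close>, of order \<open>n powr (- q 1)\<close>; the other factors add up to order
  \<open>sqrt n\<close>, which is smaller than \<open>1 / y\<close> because
  \<open>q 1 > 1/2\<close>.\<close>

lemma c_tendsto_0: "c \<longlonglongrightarrow> 0"
proof (rule tendsto_sandwich[of "\<lambda>_. 0"])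
  show "eventually (\<lambda>n. 0 \<le> c n) sequentially"
    by (intro always_eventually) (auto simp: c_def intro!: sum_nonneg mult_nonneg_nonneg Q_nonneg)
  have "c n \<le> 4 * 2 powr q 1 * n powr (1/2 - q 1)" if n: "n \<ge> 1" for n
  proof -
    define y where "y = (2 / n) powr q 1"
    have y: "Q j \<le> y" if "2 * j \<ge> n" for j
    proof -
      have "Q j \<le> (1 / j) powr q 1" using that n by (intro Q_le_powr) auto
      also have "\<dots> \<le> y" unfolding y_def using that n q_1 by (intro powr_mono2) (auto simp: field_simps)
      finally show ?thesis .
    qed
    have "c n \<le> (\<Sum>j=1..n. y * (Q j + Q (Suc n - j)))"
      unfolding c_def
    proof (intro sum_mono)
      fix j assume j: "j \<in> {1..n}"
      show "Q j * Q (Suc n - j) \<le> y * (Q j + Q (Suc n - j))"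
      proof (cases "2 * j \<ge> n")
        case True
        then have "Q j * Q (Suc n - j) \<le> y * Q (Suc n - j)" using y Q_nonneg by (intro mult_right_mono) auto
        then show ?thesis using Q_nonneg[of j] by (simp add: y_def algebra_simps add_increasing)
      next
        case False
        then have "Q j * Q (Suc n - j) \<le> Q j * y" using y[of "Suc n - j"] Q_nonneg by (intro mult_left_mono) auto
        then show ?thesis using Q_nonneg[of "Suc n - j"] by (simp add: y_def algebra_simps add_increasing2)
      qed
    qed
    also have "\<dots> = y * ((\<Sum>j=1..n. Q j) + (\<Sum>j=1..n. Q (Suc n - j)))"
      by (simp only: sum_distrib_left[symmetric] sum.distrib)
    also have "(\<Sum>j=1..n. Q (Suc n - j)) = (\<Sum>j=1..n. Q j)"
      by (rule sum.reindex_bij_witness[of _ "\<lambda>i. Suc n - i" "\<lambda>i. Suc n - i"]) auto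
    also have "y * ((\<Sum>j=1..n. Q j) + (\<Sum>j=1..n. Q j)) \<le> y * (2 * sqrt n + 2 * sqrt n)"
    proof -
      have "(\<Sum>j=1..n. Q j) \<le> (\<Sum>j=1..n. 1 / sqrt (real j))"
      proof (intro sum_mono)
        fix j assume "j \<in> {1..n}"
        then have j: "j \<ge> 1" by simp
        have "Q j \<le> (1 / j) powr q 1" by (rule Q_le_powr[OF j])
        also have "\<dots> \<le> (1 / j) powr (1/2)" using j q_1 by (intro powr_mono') auto
        also have "\<dots> = 1 / sqrt j" using j by (simp add: powr_half_sqrt real_sqrt_divide)
        finally show "Q j \<le> 1 / sqrt j" .
      qed
      also have "\<dots> \<le> 2 * sqrt n" by (rule sum_inverse_sqrt_le)
      finally show ?thesis by (intro mult_left_mono) (auto simp: y_def)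
    qed
    also have "\<dots> = 4 * 2 powr q 1 * n powr (1/2 - q 1)"
      using n by (simp add: y_def powr_divide powr_diff powr_half_sqrt)
    finally show ?thesis .
  qed
  then show "eventually (\<lambda>n. c n \<le> 4 * 2 powr q 1 * n powr (1/2 - q 1)) sequentially"
    by (auto simp: eventually_sequentially)
  have "(\<lambda>n. real n powr (1/2 - q 1)) \<longlonglongrightarrow> 0"
    using q_1 by (intro tendsto_neg_powr filterlim_real_sequentially) auto
  then show "(\<lambda>n. 4 * 2 powr q 1 * real n powr (1/2 - q 1)) \<longlonglongrightarrow> 0"
    by (rule tendsto_mult_right_zero)
qed simp

text \<open>\<open>c_increments\<close> with \<open>n\<close> sent to infinity.\<close>

lemma c_le: assumes "k \<ge> 1" shows "c k \<le> C * (k * (Q k)\<^sup>2)"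
proof -
  have "c k - C * (k * (Q k)\<^sup>2) \<le> c n" if "n \<ge> k" for n
    using c_increments[OF assms that] C_ge_1 by (smt (verit) mult_nonneg_nonneg of_nat_0_le_iff zero_le_power2)
  then have "c k - C * (k * (Q k)\<^sup>2) \<le> 0"
    by (intro tendsto_lowerbound[OF c_tendsto_0]) (auto simp: eventually_sequentially)
  then show ?thesis by simp
qed

definition A where "A k = (\<Sum>j=1..k. Q j)"

lemma A_Suc: "A (Suc k) = A k + Q (Suc k)" by (simp add: A_def)

lemma A_mono: "j \<le> k \<Longrightarrow> A j \<le> A k"
  unfolding A_def by (intro sum_mono2) (auto simp: Q_nonneg)

lemma A_ge: "j \<ge> 1 \<Longrightarrow> j * Q j \<le> A j"
proof -
  assume "j \<ge> 1"
  have "(\<Sum>i=1..j. Q j) \<le> A j"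
    unfolding A_def by (intro sum_mono Q_antimono) auto
  then show ?thesis by simp
qed

lemma A_pos: "k \<ge> 1 \<Longrightarrow> A k > 0"
  using A_ge[of k] Q_pos[of k] by (smt (verit) mult_pos_pos of_nat_0_less_iff less_le_trans zero_less_one)

text \<open>In \<open>c k\<close> every second factor is at least \<open>Q k\<close>, so
  \<open>A k * Q k \<le> c k\<close>. Together with \<open>A_ge\<close>, \<open>A k\<close> and
  \<open>k * Q k\<close> are comparable.\<close>

lemma A_le: assumes "k \<ge> 1" shows "A k \<le> C * k * Q k"
proof -
  have "A k * Q k \<le> c k"
    unfolding A_def c_def sum_distrib_right
    by (intro sum_mono mult_left_mono Q_antimono) (auto simp: Q_nonneg)
  also have "\<dots> \<le> (C * k * Q k) * Q k"
    using c_le[OF assms] by (simp add: power2_eq_square mult.assoc)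
  finally show ?thesis using Q_pos[OF assms] by simp
qed

lemma Q_compare: assumes "1 \<le> j" "j \<le> k" shows "j * Q j \<le> C * k * Q k"
  using A_ge[of j] A_mono[of j k] A_le[of k] assms by linarith

lemma Q_half: assumes "1 \<le> j" "j \<le> k" "k \<le> 2 * j" shows "Q j \<le> 2 * C * Q k"
proof -
  have "j * Q j \<le> C * k * Q k" by (rule Q_compare[OF assms(1,2)])
  also have "\<dots> \<le> C * (2 * j) * Q k"
    using assms C_ge_1 Q_nonneg by (intro mult_right_mono mult_left_mono) auto
  finally have "j * Q j \<le> j * (2 * C * Q k)" by (simp add: algebra_simps)
  then show ?thesis using assms by simp
qed

text \<open>\<open>A_le\<close> says \<open>Q i \<ge> A i / (C * i)\<close>, so the reciprocal of
  \<open>A\<close> shrinks by a factor \<open>1 - 1 / (C * i)\<close> at step \<open>i\<close>, and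
  \<open>powr_prod_bound\<close> applies.\<close>

lemma A_dom:
  assumes "1 \<le> j" "j \<le> k"
  shows "A j \<le> 2 * C * k * Q k * (j / k) powr (1 / C)"
proof -
  have C0: "C > 0" using C_ge_1 by simp
  \<comment> \<open>The sequence is \<open>u i = 1 / A (i - 1)\<close>: passing from
    \<open>A (i - 1)\<close> to \<open>A i\<close> yields the factor with \<open>1 / i\<close>. The
    resulting \<open>Suc j / Suc k\<close> is traded for \<open>j / k\<close> at the cost of a
    factor 2.\<close>
  have "1 / A (Suc k - 1) \<le> 1 / A (Suc j - 1) * (Suc j / Suc k) powr (1 / C)"
  proof (rule powr_prod_bound)
    fix i assume "Suc j \<le> i"
    then have i: "i \<ge> 2" using assms by simp
    then obtain m where m: "i = Suc m" "m \<ge> 1" by (cases i) auto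
    have "A i \<le> C * i * Q i" using A_le i by simp
    then have "A i / (C * i) \<le> Q i" using C0 i by (simp add: field_simps)
    moreover have "A i = A m + Q i" by (simp add: m A_Suc)
    ultimately have "A m \<le> A i * (1 - 1 / C / i)" by (simp add: field_simps)
    then show "1 / A (Suc i - 1) \<le> 1 / A (i - 1) * (1 - 1 / C / i)"
      using A_pos[of m] A_pos[of i] m by (simp add: field_simps)
  qed (use assms C0 in \<open>auto simp: less_imp_le A_pos intro!: divide_nonneg_nonneg sum_nonneg Q_nonneg simp: A_def\<close>)
  then have "A j \<le> A k * (Suc j / Suc k) powr (1 / C)"
    using A_pos[of j] A_pos[of k] assms by (simp add: field_simps)
  also have "\<dots> \<le> (C * k * Q k) * (2 * (j / k) powr (1 / C))"
  proof (intro mult_mono)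
    have "(Suc j / Suc k) powr (1 / C) \<le> (2 * (j / k)) powr (1 / C)"
    proof (intro powr_mono2)
      have "real (Suc j) * k \<le> 2 * j * Suc k"
      proof -
        have "1 * real k \<le> real j * k" using assms by (intro mult_right_mono) auto
        then show ?thesis by (simp add: distrib_left distrib_right)
      qed
      then show "real (Suc j) / Suc k \<le> 2 * (j / k)" using assms by (simp add: field_simps)
    qed (use C0 in auto)
    also have "\<dots> = 2 powr (1 / C) * (j / k) powr (1 / C)"
      by (subst powr_mult) auto
    also have "\<dots> \<le> 2 * (j / k) powr (1 / C)"
      using C_ge_1 powr_mono[of "1 / C" 1 2] by (intro mult_right_mono) auto
    finally show "(Suc j / Suc k) powr (1 / C) \<le> 2 * (j / k) powr (1 / C)" .
    show "A k \<le> C * k * Q k" using A_le assms by simp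
  qed (use C0 Q_nonneg in auto)
  finally show ?thesis by (simp add: algebra_simps)
qed

text \<open>A Potter-type bound. Its exponent exceeds -1, so it yields an integrable majorant for
  dominated convergence, and it rules out limiting exponents \<open>S \<ge> 1\<close>.\<close>

lemma Q_dom:
  assumes "1 \<le> j" "j \<le> k"
  shows "Q j \<le> 2 * C * Q k * (j / k) powr (1 / C - 1)"
proof -
  have "j * Q j \<le> 2 * C * k * Q k * (j / k) powr (1 / C)"
    using A_ge[of j] A_dom[OF assms] assms by simp
  also have "(j / k) powr (1 / C) = (j / k) powr (1 / C - 1) * (j / k)"
    using assms by (simp add: powr_diff)
  also have "2 * C * k * Q k * ((j / k) powr (1 / C - 1) * (j / k)) = j * (2 * C * Q k * (j / k) powr (1 / C - 1))"
    using assms by simp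
  finally show ?thesis using assms by simp
qed

section \<open>The maximum principle for the local exponent\<close>

text \<open>The price of the penalty in \<open>averaging\<close>. For \<open>i \<ge> k / 2\<close>
  the harmonic difference is at most \<open>2 * (k - i) / k\<close> and absorbs the large
  \<open>q (k - i)\<close>; for \<open>i < k / 2\<close> the factor \<open>q (k - i)\<close> is of
  order at most \<open>Q k / k\<close>, and \<open>sum_harm_below_diff\<close> treats the
  rest.\<close>

lemma sum_harm_below_weights:
  assumes k: "k \<ge> 2"
  shows "(\<Sum>i=1..<k. (harm_below k - harm_below i) * (Q i * q (k - i))) \<le> 8 * M * C ^ 3 * (Q k)\<^sup>2"
proof -
  have C0: "C > 0" using C_ge_1 by simp
  have *: "(harm_below k - harm_below i) * (Q i * q (k - i)) \<le>
      4 * M * C * Q k / k * Q (k - i) + 4 * M * C * Q k / k * ((harm_below k - harm_below i) * Q i)"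
    if i: "i \<in> {1..<k}" for i
  proof -
    define j where "j = k - i"
    have j: "j \<ge> 1" "j \<le> k" "real j = real k - i" using i by (auto simp: j_def)
    have h: "harm_below k - harm_below i \<ge> 0" using harm_below_mono[of i k] i by simp
    have nn: "4 * M * C * Q k / k * Q j \<ge> 0" "4 * M * C * Q k / k * ((harm_below k - harm_below i) * Q i) \<ge> 0"
      using M_pos C0 Q_nonneg h by auto
    show ?thesis
    proof (cases "k \<le> 2 * i")
      case True
      have "harm_below k - harm_below i \<le> j / i" using harm_below_diff_le[of i k] i j by simp
      also have "\<dots> \<le> 2 * j / k"
      proof -
        have "real j * k \<le> real j * (2 * i)" using True by (intro mult_left_mono) auto
        then show ?thesis using i by (simp add: field_simps)
      qed
      finally have "(harm_below k - harm_below i) * (Q i * q j) \<le> (2 * j / k) * (Q i * q j)"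
        using Q_nonneg q_pos[of j] j by (intro mult_right_mono) auto
      also have "\<dots> = 2 / k * Q i * (j * q j)" by simp
      also have "\<dots> \<le> 2 / k * (2 * C * Q k) * (M * Q j)"
      proof (rule mult_mono[OF mult_left_mono])
        show "Q i \<le> 2 * C * Q k" using Q_half[of i k] True i by simp
        show "j * q j \<le> M * Q j"
          using mult_right_mono[OF e_le[OF j(1)] Q_nonneg[of j]] eQ[OF j(1)] by linarith
      qed (use Q_nonneg C0 q_pos[of j] j in auto)
      also have "\<dots> = 4 * M * C * Q k / k * Q j" by simp
      finally show ?thesis using nn by (simp add: j_def)
    next
      case False
      have jk: "k \<le> 2 * j" using False i by (auto simp: j_def)
      have "q j \<le> M * Q j / j" by (rule q_le[OF j(1)])
      also have "\<dots> \<le> M * (2 * C * Q k) / (k / 2)"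
        using Q_half[OF j(1,2) jk] jk j(1) k M_pos Q_nonneg C0
        by (intro frac_le mult_left_mono mult_nonneg_nonneg) auto
      also have "\<dots> = 4 * M * C * Q k / k" by simp
      finally have "(harm_below k - harm_below i) * Q i * q j \<le> (harm_below k - harm_below i) * Q i * (4 * M * C * Q k / k)"
        using h Q_nonneg by (intro mult_left_mono) auto
      then show ?thesis using nn unfolding j_def[symmetric] by (simp add: algebra_simps)
    qed
  qed
  have sum_le_A: "(\<Sum>i=1..<k. Q i) \<le> A k"
    unfolding A_def by (intro sum_mono2) (auto simp: Q_nonneg)
  have Ak: "A k \<le> C * k * Q k" using A_le k by simp
  have "(\<Sum>i=1..<k. Q (k - i)) = (\<Sum>i=1..<k. Q i)"
    using sum_flip[of "\<lambda>i j. Q j" k] by simp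
  also have "\<dots> \<le> C * k * Q k" using sum_le_A Ak by linarith
  \<comment> \<open>The extra factor \<open>C\<close> gives both sums the same bound.\<close>
  also have "\<dots> \<le> C * (C * k * Q k)"
    using C_ge_1 Q_nonneg[of k] mult_right_mono[of 1 C "C * k * Q k"] by simp
  finally have 1: "(\<Sum>i=1..<k. Q (k - i)) \<le> C * (C * k * Q k)" .
  have "(\<Sum>i=1..<k. (harm_below k - harm_below i) * Q i) = (\<Sum>j=1..<k. A j / j)"
    unfolding A_def by (rule sum_harm_below_diff)
  also have "\<dots> \<le> (\<Sum>j=1..<k. C * Q j)"
    using A_le by (intro sum_mono) (auto simp: field_simps)
  also have "\<dots> = C * (\<Sum>j=1..<k. Q j)" by (simp add: sum_distrib_left)
  also have "\<dots> \<le> C * (C * k * Q k)"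
    using C0 sum_le_A Ak by (intro mult_left_mono) auto
  finally have 2: "(\<Sum>i=1..<k. (harm_below k - harm_below i) * Q i) \<le> C * (C * k * Q k)" .
  have "(\<Sum>i=1..<k. (harm_below k - harm_below i) * (Q i * q (k - i))) \<le>
      4 * M * C * Q k / k * (\<Sum>i=1..<k. Q (k - i)) + 4 * M * C * Q k / k * (\<Sum>i=1..<k. (harm_below k - harm_below i) * Q i)"
    unfolding sum_distrib_left sum.distrib[symmetric] by (intro sum_mono *)
  also have "\<dots> \<le> 4 * M * C * Q k / k * (C * (C * k * Q k)) + 4 * M * C * Q k / k * (C * (C * k * Q k))"
    using M_pos C0 Q_nonneg by (intro add_mono mult_left_mono 1 2) auto
  also have "\<dots> = 8 * M * C ^ 3 * (Q k)\<^sup>2"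
    using k by (simp add: power2_eq_square power3_eq_cube)
  finally show ?thesis .
qed

text \<open>A quantitative strong maximum principle, with \<sigma> = 1 for maxima and -1 for minima.
  The slacks \<open>d i\<close> are nonnegative and \<open>averaging\<close> makes their weighted
  sum small; every weight is at least \<open>q 1 * (Q k)\<^sup>2 / k\<close>, so their plain mean is
  small too.\<close>

lemma mean_deviation:
  assumes k: "k \<ge> 2" and "\<eta> > 0" and \<sigma>: "\<bar>\<sigma>\<bar> = 1"
    and max: "\<And>i. 1 \<le> i \<Longrightarrow> i < k \<Longrightarrow> \<sigma> * e i \<le> \<sigma> * e k + \<eta> * (harm_below k - harm_below i)"
  shows "(\<Sum>i=1..<k. \<bar>e i - e k\<bar>) / k \<le> (8 * M * C ^ 3 / q 1 + 1) * \<eta> + \<theta> * M\<^sup>2 / (2 * q 1) / k"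
proof -
  define d where "d i = \<sigma> * e k + \<eta> * (harm_below k - harm_below i) - \<sigma> * e i" for i
  have Qk: "Q k > 0" using Q_pos k by simp
  have d_nonneg: "d i \<ge> 0" if "i \<in> {1..<k}" for i using max[of i] that by (simp add: d_def)
  have "(\<Sum>i=1..<k. d i) * (q 1 * (Q k)\<^sup>2 / k) \<le> (\<Sum>i=1..<k. d i * (Q i * q (k - i)))"
    unfolding sum_distrib_right
  proof (intro sum_mono mult_left_mono d_nonneg)
    fix i assume i: "i \<in> {1..<k}"
    have "q 1 * (Q k)\<^sup>2 / k = Q k * (q 1 * Q k / k)" by (simp add: power2_eq_square)
    also have "\<dots> \<le> Q i * (q 1 * Q (k - i) / (k - i))"
      using i Qk q_1 Q_antimono[of i k] Q_antimono[of "k - i" k] Q_nonneg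
      by (intro mult_mono frac_le mult_left_mono) auto
    also have "\<dots> \<le> Q i * q (k - i)"
      using i q_ge[of "k - i"] Q_nonneg by (intro mult_left_mono) auto
    finally show "q 1 * (Q k)\<^sup>2 / k \<le> Q i * q (k - i)" .
  qed auto
  also have "(\<Sum>i=1..<k. d i * (Q i * q (k - i))) =
      \<sigma> * (\<Sum>i=1..<k. (e k - e i) * (Q i * q (k - i))) + \<eta> * (\<Sum>i=1..<k. (harm_below k - harm_below i) * (Q i * q (k - i)))"
    unfolding sum_distrib_left sum.distrib[symmetric]
    by (intro sum.cong refl) (simp add: d_def algebra_simps)
  also have "\<dots> \<le> \<theta> / 2 * M * Q k * (M * Q k / k) + \<eta> * (8 * M * C ^ 3 * (Q k)\<^sup>2)"
  proof (intro add_mono mult_left_mono sum_harm_below_weights k)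
    have "\<sigma> * (\<theta> / 2 * e k * Q k * q k) \<le> 1 * (\<theta> / 2 * e k * Q k * q k)"
      using \<sigma> theta_pos e_pos[of k] Qk q_pos[of k] k by (intro mult_right_mono) auto
    also have "1 * (\<theta> / 2 * e k * Q k * q k) \<le> \<theta> / 2 * M * Q k * (M * Q k / k)"
      unfolding mult_1 using theta_pos e_le[of k] q_le[of k] e_pos[of k] Qk q_pos[of k] k M_pos
      by (intro mult_mono mult_left_mono mult_nonneg_nonneg) auto
    finally show "\<sigma> * (\<Sum>i=1..<k. (e k - e i) * (Q i * q (k - i))) \<le> \<theta> / 2 * M * Q k * (M * Q k / k)"
      by (simp only: averaging[OF k])
  qed (use \<open>\<eta> > 0\<close> in auto)
  also have "\<dots> = (\<theta> * M\<^sup>2 / 2 + \<eta> * 8 * M * C ^ 3 * k) / q 1 * (q 1 * (Q k)\<^sup>2 / k)"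
    using k q_1 by (simp add: power2_eq_square field_simps)
  finally have *: "(\<Sum>i=1..<k. d i) \<le> (\<theta> * M\<^sup>2 / 2 + \<eta> * 8 * M * C ^ 3 * k) / q 1"
    by (rule mult_right_le_imp_le) (use k q_1 Qk in simp)
  have "(\<Sum>i=1..<k. \<bar>e i - e k\<bar>) \<le> (\<Sum>i=1..<k. d i + \<eta> * (harm_below k - harm_below i))"
  proof (intro sum_mono)
    fix i assume i: "i \<in> {1..<k}"
    have "\<bar>e i - e k\<bar> = \<bar>\<sigma> * (e i - e k)\<bar>" using \<sigma> by (simp add: abs_mult)
    also have "\<dots> = \<bar>\<eta> * (harm_below k - harm_below i) - d i\<bar>" by (simp add: d_def algebra_simps)
    also have "\<dots> \<le> d i + \<eta> * (harm_below k - harm_below i)"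
    proof -
      have "\<eta> * (harm_below k - harm_below i) \<ge> 0" using \<open>\<eta> > 0\<close> harm_below_mono[of i k] i by simp
      then show ?thesis using d_nonneg[OF i] by linarith
    qed
    finally show "\<bar>e i - e k\<bar> \<le> d i + \<eta> * (harm_below k - harm_below i)" .
  qed
  also have "\<dots> = (\<Sum>i=1..<k. d i) + \<eta> * (\<Sum>i=1..<k. (harm_below k - harm_below i) * 1)"
    by (simp add: sum.distrib sum_distrib_left)
  \<comment> \<open>By \<open>sum_harm_below_diff\<close> every summand becomes
    \<open>j / j\<close>, so the total penalty is only linear in \<open>k\<close>.\<close>
  also have "(\<Sum>i=1..<k. (harm_below k - harm_below i) * 1) = real (k - 1)"
    unfolding sum_harm_below_diff by simp
  also have "(\<Sum>i=1..<k. d i) + \<eta> * real (k - 1) \<le> (\<theta> * M\<^sup>2 / 2 + \<eta> * 8 * M * C ^ 3 * k) / q 1 + \<eta> * k"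
    using * \<open>\<eta> > 0\<close> by (intro add_mono mult_left_mono) auto
  also have "\<dots> = ((8 * M * C ^ 3 / q 1 + 1) * \<eta> + \<theta> * M\<^sup>2 / (2 * q 1) / k) * k"
    using k q_1 by (simp add: field_simps)
  finally show ?thesis using k by (simp add: pos_divide_le_eq)
qed

text \<open>With \<sigma> = 1 the value \<open>\<sigma> * L\<close> is the upper limit of
  \<open>e\<close>, with \<sigma> = -1 the lower one. Penalties \<open>1 / (n + 1)\<close> produce
  the maximisers \<open>\<kappa> n\<close>, along which the bound of \<open>mean_deviation\<close>
  tends to 0.\<close>

lemma extremal_subsequence:
  assumes \<sigma>: "\<bar>\<sigma>\<bar> = (1::real)"
    and up: "\<And>\<eta>. \<eta> > 0 \<Longrightarrow> eventually (\<lambda>k. \<sigma> * e k < L + \<eta>) sequentially"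
    and low: "\<And>\<eta> N. \<eta> > 0 \<Longrightarrow> \<exists>k\<ge>N. \<sigma> * e k > L - \<eta>"
  obtains \<kappa> where "filterlim \<kappa> at_top sequentially"
    and "(\<lambda>n. (\<Sum>i=1..<\<kappa> n. \<bar>e i - \<sigma> * L\<bar>) / \<kappa> n) \<longlonglongrightarrow> 0"
proof -
  have \<sigma>2: "\<sigma> * \<sigma> = 1" using \<sigma> by (auto simp: abs_if split: if_splits)
  have bound: "\<bar>\<sigma> * e k\<bar> \<le> M" if "1 \<le> k" for k
    using e_pos[OF that] e_le[OF that] \<sigma> by (simp add: abs_mult)
  have "\<exists>k\<ge>n + 2. \<sigma> * e k > L - 1 / (real n + 1) \<and>
      (\<forall>i. 1 \<le> i \<and> i < k \<longrightarrow> \<sigma> * e i \<le> \<sigma> * e k + 1 / (real n + 1) * (harm_below k - harm_below i))" for n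
    by (rule penalised_maximiser[OF bound harm_below_mono harm_below_at_top _ low]) auto
  then obtain \<kappa> where \<kappa>: "\<And>n. \<kappa> n \<ge> n + 2" "\<And>n. \<sigma> * e (\<kappa> n) > L - 1 / (real n + 1)"
      "\<And>n i. 1 \<le> i \<Longrightarrow> i < \<kappa> n \<Longrightarrow> \<sigma> * e i \<le> \<sigma> * e (\<kappa> n) + 1 / (real n + 1) * (harm_below (\<kappa> n) - harm_below i)"
    by metis
  have top: "filterlim \<kappa> at_top sequentially"
    by (rule filterlim_at_top_mono[OF filterlim_ident]) (use \<kappa>(1) in \<open>auto intro!: always_eventually intro: order_trans[OF _ \<kappa>(1)]\<close>)
  have inv: "(\<lambda>n. 1 / (real n + 1)) \<longlonglongrightarrow> 0"
    using LIMSEQ_inverse_real_of_nat by (simp add: inverse_eq_divide add.commute)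
  have lim: "(\<lambda>n. \<sigma> * e (\<kappa> n)) \<longlonglongrightarrow> L"
  proof (rule order_tendstoI)
    fix a assume "a < L"
    have "(\<lambda>n. L - 1 / (real n + 1)) \<longlonglongrightarrow> L - 0" by (intro tendsto_intros inv)
    then have "eventually (\<lambda>n. a < L - 1 / (real n + 1)) sequentially"
      using \<open>a < L\<close> by (intro order_tendstoD(1)[of _ L]) auto
    then show "eventually (\<lambda>n. a < \<sigma> * e (\<kappa> n)) sequentially"
      by eventually_elim (use \<kappa>(2) less_trans in blast)
  next
    fix a assume "L < a"
    then have "eventually (\<lambda>k. \<sigma> * e k < L + (a - L)) sequentially" by (intro up) simp
    then show "eventually (\<lambda>n. \<sigma> * e (\<kappa> n) < a) sequentially"
      using top by (auto simp: filterlim_iff)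
  qed
  define K where "K = 8 * M * C ^ 3 / q 1 + 1"
  define K' where "K' = \<theta> * M\<^sup>2 / (2 * q 1)"
  have "(\<Sum>i=1..<\<kappa> n. \<bar>e i - \<sigma> * L\<bar>) / \<kappa> n \<le>
      K * (1 / (real n + 1)) + K' / \<kappa> n + \<bar>\<sigma> * e (\<kappa> n) - L\<bar>" for n
  proof -
    have k: "\<kappa> n \<ge> 2" using \<kappa>(1)[of n] by simp
    have "\<bar>e (\<kappa> n) - \<sigma> * L\<bar> = \<bar>\<sigma> * (e (\<kappa> n) - \<sigma> * L)\<bar>" using \<sigma> by (simp add: abs_mult)
    also have "\<dots> = \<bar>\<sigma> * e (\<kappa> n) - L\<bar>" by (simp add: right_diff_distrib mult.assoc[symmetric] \<sigma>2)
    finally have eq: "\<bar>e (\<kappa> n) - \<sigma> * L\<bar> = \<bar>\<sigma> * e (\<kappa> n) - L\<bar>" .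
    have "(\<Sum>i=1..<\<kappa> n. \<bar>e i - \<sigma> * L\<bar>) \<le> (\<Sum>i=1..<\<kappa> n. \<bar>e i - e (\<kappa> n)\<bar> + \<bar>\<sigma> * e (\<kappa> n) - L\<bar>)"
      unfolding eq[symmetric] by (intro sum_mono) linarith
    also have "\<dots> = (\<Sum>i=1..<\<kappa> n. \<bar>e i - e (\<kappa> n)\<bar>) + real (\<kappa> n - 1) * \<bar>\<sigma> * e (\<kappa> n) - L\<bar>"
      by (simp add: sum.distrib)
    also have "\<dots> \<le> (\<Sum>i=1..<\<kappa> n. \<bar>e i - e (\<kappa> n)\<bar>) + real (\<kappa> n) * \<bar>\<sigma> * e (\<kappa> n) - L\<bar>"
      by (intro add_left_mono mult_right_mono) auto
    finally have "(\<Sum>i=1..<\<kappa> n. \<bar>e i - \<sigma> * L\<bar>) / \<kappa> n \<le>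
        ((\<Sum>i=1..<\<kappa> n. \<bar>e i - e (\<kappa> n)\<bar>) + real (\<kappa> n) * \<bar>\<sigma> * e (\<kappa> n) - L\<bar>) / \<kappa> n"
      by (rule divide_right_mono) simp
    also have "\<dots> = (\<Sum>i=1..<\<kappa> n. \<bar>e i - e (\<kappa> n)\<bar>) / \<kappa> n + \<bar>\<sigma> * e (\<kappa> n) - L\<bar>"
      using k by (simp add: add_divide_distrib)
    also have "(\<Sum>i=1..<\<kappa> n. \<bar>e i - e (\<kappa> n)\<bar>) / \<kappa> n \<le> K * (1 / (real n + 1)) + K' / \<kappa> n"
      unfolding K_def K'_def by (rule mean_deviation[OF k _ \<sigma> \<kappa>(3)]) auto
    finally show ?thesis by simp
  qed
  note bnd = this
  have "(\<lambda>n. K * (1 / (real n + 1)) + K' / \<kappa> n + \<bar>\<sigma> * e (\<kappa> n) - L\<bar>) \<longlonglongrightarrow> K * 0 + 0 + \<bar>L - L\<bar>"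
    by (intro tendsto_intros inv lim real_tendsto_divide_at_top[OF tendsto_const]
        filterlim_compose[OF filterlim_real_sequentially top])
  then have blim: "(\<lambda>n. K * (1 / (real n + 1)) + K' / \<kappa> n + \<bar>\<sigma> * e (\<kappa> n) - L\<bar>) \<longlonglongrightarrow> 0"
    by simp
  have "(\<lambda>n. (\<Sum>i=1..<\<kappa> n. \<bar>e i - \<sigma> * L\<bar>) / \<kappa> n) \<longlonglongrightarrow> 0"
  proof (rule tendsto_sandwich[OF _ _ tendsto_const blim])
    show "eventually (\<lambda>n. 0 \<le> (\<Sum>i=1..<\<kappa> n. \<bar>e i - \<sigma> * L\<bar>) / \<kappa> n) sequentially"
      by (intro always_eventually allI divide_nonneg_nonneg sum_nonneg) auto
  qed (intro always_eventually allI bnd)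
  with top show ?thesis by (rule that)
qed

section \<open>Power-law comparison of \<open>Q\<close> where \<open>e\<close> is close to a
  constant\<close>

text \<open>To first order \<open>ln (Q i / Q (Suc i))\<close> is \<open>e i / i\<close> and
  \<open>ln (Suc i / i)\<close> is \<open>1 / i\<close>. The lower bounds on \<open>i\<close> keep
  both quantities at most 1/2, where the quadratic remainder estimate holds.\<close>

lemma ln_Q_step:
  assumes i: "i \<ge> 2" "real i \<ge> 2 * M"
  shows "\<bar>ln (Q i) - ln (Q (Suc i)) - S * (ln (Suc i) - ln i)\<bar> \<le> \<bar>e i - S\<bar> / i + (2 * M\<^sup>2 + 2 * \<bar>S\<bar>) / i\<^sup>2"
proof -
  define x where "x = e i / i"
  define y where "y = 1 / real i"
  have x: "0 \<le> x" "x \<le> M / i" "x \<le> 1/2"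
  proof -
    show "0 \<le> x" using e_pos[of i] i by (auto simp: x_def)
    show le: "x \<le> M / i" using e_le[of i] i by (auto simp: x_def divide_right_mono)
    have "M / i \<le> 1/2" using i by (simp add: field_simps)
    with le show "x \<le> 1/2" by linarith
  qed
  have "\<bar>ln (1 + - x) - - x\<bar> \<le> 2 * (- x)\<^sup>2"
    using x by (intro abs_ln_one_plus_x_minus_x_bound) auto
  moreover have "ln (Q (Suc i)) = ln (Q i) + ln (1 + - x)"
    using Q_ratio[of i] Q_pos[of i] i x by (simp add: x_def ln_mult)
  ultimately have 1: "\<bar>ln (Q i) - ln (Q (Suc i)) - x\<bar> \<le> 2 * x\<^sup>2" by (simp add: abs_minus_commute)
  have "\<bar>ln (1 + y) - y\<bar> \<le> 2 * y\<^sup>2"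
    using i by (intro abs_ln_one_plus_x_minus_x_bound) (auto simp: y_def)
  moreover have "ln (Suc i) - ln i = ln (1 + y)"
    using i ln_div[of "Suc i" i] by (simp add: y_def field_simps)
  ultimately have 2: "\<bar>(ln (Suc i) - ln i) - y\<bar> \<le> 2 * y\<^sup>2" by simp
  have "x\<^sup>2 \<le> M\<^sup>2 / i\<^sup>2"
    using power_mono[OF x(2,1), of 2] by (simp add: power_divide)
  then have 3: "2 * x\<^sup>2 \<le> 2 * M\<^sup>2 / i\<^sup>2" by simp
  have "\<bar>S * ((ln (Suc i) - ln i) - y)\<bar> \<le> \<bar>S\<bar> * (2 * y\<^sup>2)"
    unfolding abs_mult using 2 by (rule mult_left_mono) simp
  also have "\<dots> = 2 * \<bar>S\<bar> / i\<^sup>2" by (simp add: y_def power_divide)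
  finally have 4: "\<bar>S * ((ln (Suc i) - ln i) - y)\<bar> \<le> 2 * \<bar>S\<bar> / i\<^sup>2" .
  have 5: "x - S * y = (e i - S) / i" by (simp add: x_def y_def diff_divide_distrib)
  have "\<bar>x - S * y\<bar> = \<bar>e i - S\<bar> / i" unfolding 5 by simp
  moreover have "ln (Q i) - ln (Q (Suc i)) - S * (ln (Suc i) - ln i) =
      (ln (Q i) - ln (Q (Suc i)) - x) + (x - S * y) - S * ((ln (Suc i) - ln i) - y)"
    by (simp add: algebra_simps)
  ultimately show ?thesis using 1 3 4 by (simp add: add_divide_distrib)
qed

text \<open>Sums \<open>ln_Q_step\<close>, with all denominators lowered to those at
  \<open>m\<close>. When \<open>m\<close> is of order \<open>k\<close>, the first term is a multiple
  of the mean deviation of \<open>e\<close> and the second is of order \<open>1 / k\<close>.\<close>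

lemma ln_Q_diff:
  assumes m: "m \<ge> 2" "real m \<ge> 2 * M" "m \<le> k"
  shows "\<bar>ln (Q m) - ln (Q k) - S * (ln k - ln m)\<bar> \<le>
    (\<Sum>i=1..<k. \<bar>e i - S\<bar>) / m + (2 * M\<^sup>2 + 2 * \<bar>S\<bar>) * k / m\<^sup>2"
proof -
  define K where "K = 2 * M\<^sup>2 + 2 * \<bar>S\<bar>"
  have K: "K \<ge> 0" by (simp add: K_def)
  have "\<bar>ln (Q m) - ln (Q k) - S * (ln k - ln m)\<bar> \<le> (\<Sum>i=m..<k. \<bar>e i - S\<bar> / m + K / m\<^sup>2)"
    using m(3)
  proof (induction k rule: dec_induct)
    case (step k)
    have k: "k \<ge> 2" "real k \<ge> 2 * M" using step m by auto
    have "\<bar>e k - S\<bar> / k + K / k\<^sup>2 \<le> \<bar>e k - S\<bar> / m + K / m\<^sup>2"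
      using step m K by (intro add_mono divide_left_mono power_mono) auto
    then have "\<bar>ln (Q k) - ln (Q (Suc k)) - S * (ln (Suc k) - ln k)\<bar> \<le> \<bar>e k - S\<bar> / m + K / m\<^sup>2"
      using ln_Q_step[OF k, of S] by (simp add: K_def)
    moreover have "(\<Sum>i=m..<Suc k. \<bar>e i - S\<bar> / m + K / m\<^sup>2) =
        (\<Sum>i=m..<k. \<bar>e i - S\<bar> / m + K / m\<^sup>2) + (\<bar>e k - S\<bar> / m + K / m\<^sup>2)"
      using step by simp
    moreover have "ln (Q m) - ln (Q (Suc k)) - S * (ln (Suc k) - ln m) =
        (ln (Q m) - ln (Q k) - S * (ln k - ln m)) + (ln (Q k) - ln (Q (Suc k)) - S * (ln (Suc k) - ln k))"
      by (simp add: algebra_simps)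
    ultimately show ?case using step.IH by linarith
  qed simp
  also have "\<dots> = (\<Sum>i=m..<k. \<bar>e i - S\<bar>) / m + real (k - m) * K / m\<^sup>2"
    by (simp add: sum.distrib sum_divide_distrib)
  also have "\<dots> \<le> (\<Sum>i=1..<k. \<bar>e i - S\<bar>) / m + K * k / m\<^sup>2"
  proof (intro add_mono divide_right_mono)
    show "(\<Sum>i=m..<k. \<bar>e i - S\<bar>) \<le> (\<Sum>i=1..<k. \<bar>e i - S\<bar>)"
      using m by (intro sum_mono2) auto
    show "real (k - m) * K \<le> K * k" using K by (simp add: mult.commute mult_left_mono)
  qed auto
  finally show ?thesis by (simp add: K_def)
qed

text \<open>Exact precursor of the exponent equation:
  \<open>e i * Q i = i * (Q i - Q (Suc i))\<close>, both resulting convolutions are symmetrised, and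
  \<open>c_Suc\<close> eliminates \<open>c k\<close>.\<close>

lemma conv_eQQ:
  assumes k: "k \<ge> 2"
  shows "(\<Sum>i=1..<k. e i * (Q i * Q (k - i))) = c (k - 1) / 2 + real (k - 1) / 2 * \<theta> * (Q k)\<^sup>2"
proof -
  \<comment> \<open>Indexed by the total \<open>K\<close> of the two arguments, so that
    \<open>half\<close> covers both \<open>k\<close> and \<open>Suc k\<close>.\<close>
  define cc where "cc K = (\<Sum>i=1..<K. Q i * Q (K - i))" for K
  have half: "(\<Sum>i=1..<K. i * (Q i * Q (K - i))) = K / 2 * cc K" for K
  proof -
    have "(\<Sum>i=1..<K. i * (Q i * Q (K - i))) = (\<Sum>i=1..<K. real (K - i) * (Q i * Q (K - i)))"
      using sum_flip[of "\<lambda>i j. i * (Q i * Q j)" K] by (simp add: mult.commute)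
    moreover have "(\<Sum>i=1..<K. i * (Q i * Q (K - i))) + (\<Sum>i=1..<K. real (K - i) * (Q i * Q (K - i))) = K * cc K"
      unfolding sum.distrib[symmetric] cc_def sum_distrib_left
      by (intro sum.cong refl) (auto simp: of_nat_diff algebra_simps)
    ultimately have "2 * (\<Sum>i=1..<K. i * (Q i * Q (K - i))) = K * cc K" by linarith
    then show ?thesis by simp
  qed
  have c1: "c (k - 1) = cc k" and c2: "c k = cc (Suc k)"
    using k by (auto simp: c_def cc_def atLeastLessThanSuc_atLeastAtMost intro!: sum.cong)
  have "(\<Sum>i=1..<k. e i * (Q i * Q (k - i))) = (\<Sum>i=1..<k. i * (Q i * Q (k - i)) - i * (Q (Suc i) * Q (k - i)))"
  proof (intro sum.cong refl)
    fix i assume "i \<in> {1..<k}"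
    then have "e i * Q i = i * (Q i - Q (Suc i))" using eQ[of i] Q_Suc[of i] by simp
    then have "(e i * Q i) * Q (k - i) = i * (Q i - Q (Suc i)) * Q (k - i)" by (simp only:)
    then show "e i * (Q i * Q (k - i)) = i * (Q i * Q (k - i)) - i * (Q (Suc i) * Q (k - i))"
      by (simp add: algebra_simps)
  qed
  also have "\<dots> = k / 2 * cc k - (\<Sum>i=1..<k. i * (Q (Suc i) * Q (k - i)))"
    by (simp only: sum_subtractf half)
  \<comment> \<open>The shift is \<open>j = i + 1\<close>; the added term \<open>j = 1\<close>
    carries the factor 0.\<close>
  also have "(\<Sum>i=1..<k. i * (Q (Suc i) * Q (k - i))) = (\<Sum>j=1..<Suc k. (real j - 1) * (Q j * Q (Suc k - j)))"
    using sum.shift_bounds_Suc_ivl[of "\<lambda>j. (real j - 1) * (Q j * Q (Suc k - j))" 1 k]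
      sum.atLeast_Suc_lessThan[of 1 "Suc k" "\<lambda>j. (real j - 1) * (Q j * Q (Suc k - j))"] k by simp
  also have "\<dots> = Suc k / 2 * cc (Suc k) - cc (Suc k)"
    by (simp only: left_diff_distrib sum_subtractf half mult_1) (simp only: cc_def)
  also have "cc (Suc k) = cc k - \<theta> * (Q k)\<^sup>2"
  proof -
    have "k - 1 \<ge> 1" "Suc (k - 1) = k" using k by auto
    then show ?thesis using c_Suc[of "k - 1"] c1 c2 by simp
  qed
  also have "real k / 2 * cc k - (Suc k / 2 * (cc k - \<theta> * (Q k)\<^sup>2) - (cc k - \<theta> * (Q k)\<^sup>2)) =
      cc k / 2 + real (k - 1) / 2 * \<theta> * (Q k)\<^sup>2"
    using k by (simp add: of_nat_diff field_simps)
  finally show ?thesis by (simp only: c1)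
qed

section \<open>Limits along indices with vanishing mean deviation\<close>

context
  fixes \<kappa> :: "nat \<Rightarrow> nat" and S :: real
  assumes top: "filterlim \<kappa> at_top sequentially"
    and mean: "(\<lambda>n. (\<Sum>i=1..<\<kappa> n. \<bar>e i - S\<bar>) / \<kappa> n) \<longlonglongrightarrow> 0"
begin

lemma real_kappa_top: "filterlim (\<lambda>n. real (\<kappa> n)) at_top sequentially"
  by (rule filterlim_compose[OF filterlim_real_sequentially top])

lemma eventually_kappa_ge: "eventually (\<lambda>n. \<kappa> n \<ge> K) sequentially"
  using top by (simp add: filterlim_at_top)

text \<open>\<open>ln_Q_diff\<close> between \<open>m n\<close> and \<open>\<kappa> n\<close>: the
  two indices are of the same order, so both error terms vanish.\<close>

lemma Q_ratio_limit:
  assumes x: "x > 0" and m: "\<And>n. m n \<le> \<kappa> n" and lim: "(\<lambda>n. m n / \<kappa> n) \<longlonglongrightarrow> x"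
  shows "(\<lambda>n. Q (m n) / Q (\<kappa> n)) \<longlonglongrightarrow> x powr (- S)"
proof -
  define K where "K = 2 * M\<^sup>2 + 2 * \<bar>S\<bar>"
  define r where "r = (\<lambda>n. real (m n) / real (\<kappa> n))"
  have rlim: "r \<longlonglongrightarrow> x" unfolding r_def by (rule lim)
  have "filterlim (\<lambda>n. r n * \<kappa> n) at_top sequentially"
    by (rule filterlim_tendsto_pos_mult_at_top[OF rlim x real_kappa_top])
  moreover have "eventually (\<lambda>n. r n * \<kappa> n = m n) sequentially"
    using eventually_kappa_ge[of 1] by eventually_elim (simp add: r_def)
  ultimately have mtop: "filterlim (\<lambda>n. real (m n)) at_top sequentially"
    by (simp add: filterlim_cong)
  have ev: "eventually (\<lambda>n. real (m n) \<ge> max 2 (2 * M)) sequentially"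
    using mtop unfolding filterlim_at_top by blast
  have lim0: "(\<lambda>n. ln (Q (m n)) - ln (Q (\<kappa> n)) - S * (ln (\<kappa> n) - ln (m n))) \<longlonglongrightarrow> 0"
  proof (rule Lim_null_comparison)
    show "eventually (\<lambda>n. norm (ln (Q (m n)) - ln (Q (\<kappa> n)) - S * (ln (\<kappa> n) - ln (m n))) \<le>
        ((\<Sum>i=1..<\<kappa> n. \<bar>e i - S\<bar>) / \<kappa> n) / r n + K / \<kappa> n / (r n)\<^sup>2) sequentially"
      using ev eventually_kappa_ge[of 1]
    proof eventually_elim
      case (elim n)
      then have "(\<Sum>i=1..<\<kappa> n. \<bar>e i - S\<bar>) / m n = ((\<Sum>i=1..<\<kappa> n. \<bar>e i - S\<bar>) / \<kappa> n) / r n"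
        "K * \<kappa> n / (m n)\<^sup>2 = K / \<kappa> n / (r n)\<^sup>2"
        by (auto simp: r_def power2_eq_square)
      moreover have "norm (ln (Q (m n)) - ln (Q (\<kappa> n)) - S * (ln (\<kappa> n) - ln (m n))) \<le>
          (\<Sum>i=1..<\<kappa> n. \<bar>e i - S\<bar>) / m n + K * \<kappa> n / (m n)\<^sup>2"
        using ln_Q_diff[of "m n" "\<kappa> n" S] m[of n] elim by (simp add: K_def)
      ultimately show ?case by (simp only:)
    qed
    have "(\<lambda>n. ((\<Sum>i=1..<\<kappa> n. \<bar>e i - S\<bar>) / \<kappa> n) / r n + K / \<kappa> n / (r n)\<^sup>2) \<longlonglongrightarrow> 0 / x + 0 / x\<^sup>2"
      using x by (intro tendsto_intros mean rlim real_tendsto_divide_at_top[OF tendsto_const real_kappa_top]) auto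
    then show "(\<lambda>n. ((\<Sum>i=1..<\<kappa> n. \<bar>e i - S\<bar>) / \<kappa> n) / r n + K / \<kappa> n / (r n)\<^sup>2) \<longlonglongrightarrow> 0" by simp
  qed
  have "(\<lambda>n. (ln (Q (m n)) - ln (Q (\<kappa> n)) - S * (ln (\<kappa> n) - ln (m n))) - S * ln (r n)) \<longlonglongrightarrow> 0 - S * ln x"
    using x by (intro tendsto_intros lim0 rlim) auto
  then have "(\<lambda>n. exp ((ln (Q (m n)) - ln (Q (\<kappa> n)) - S * (ln (\<kappa> n) - ln (m n))) - S * ln (r n))) \<longlonglongrightarrow> exp (0 - S * ln x)"
    by (rule tendsto_exp)
  moreover have "eventually (\<lambda>n. exp ((ln (Q (m n)) - ln (Q (\<kappa> n)) - S * (ln (\<kappa> n) - ln (m n))) - S * ln (r n)) =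
      Q (m n) / Q (\<kappa> n)) sequentially"
    using ev eventually_kappa_ge[of 1]
  proof eventually_elim
    case (elim n)
    then have "ln (r n) = ln (m n) - ln (\<kappa> n)" by (simp add: r_def ln_div)
    then have "(ln (Q (m n)) - ln (Q (\<kappa> n)) - S * (ln (\<kappa> n) - ln (m n))) - S * ln (r n) = ln (Q (m n)) - ln (Q (\<kappa> n))"
      by (simp only:) (simp add: algebra_simps)
    moreover have "exp (ln (Q (m n)) - ln (Q (\<kappa> n))) = Q (m n) / Q (\<kappa> n)"
      using elim Q_pos[of "m n"] Q_pos[of "\<kappa> n"] by (simp add: exp_diff)
    ultimately show ?case by (simp only:)
  qed
  ultimately show ?thesis
    using x by (simp add: powr_def tendsto_cong)
qed

lemma ceiling_ratio_limit:
  fixes x :: real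
  assumes "x > 0"
  shows "(\<lambda>n. nat \<lceil>x * \<kappa> n\<rceil> / \<kappa> n) \<longlonglongrightarrow> x"
proof (rule tendsto_sandwich)
  show "eventually (\<lambda>n. x \<le> nat \<lceil>x * \<kappa> n\<rceil> / \<kappa> n) sequentially"
    using eventually_kappa_ge[of 1] by eventually_elim (simp add: le_divide_eq real_nat_ceiling_ge)
  show "eventually (\<lambda>n. nat \<lceil>x * \<kappa> n\<rceil> / \<kappa> n \<le> x + 1 / \<kappa> n) sequentially"
    using eventually_kappa_ge[of 1]
  proof eventually_elim
    case (elim n)
    have "x * \<kappa> n \<ge> 0" using assms by simp
    then have "real (nat \<lceil>x * \<kappa> n\<rceil>) \<le> x * \<kappa> n + 1" by linarith
    then show ?case using elim by (simp add: field_simps)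
  qed
  have "(\<lambda>n. x + 1 / \<kappa> n) \<longlonglongrightarrow> x + 0"
    by (intro tendsto_intros real_tendsto_divide_at_top[OF tendsto_const real_kappa_top])
  then show "(\<lambda>n. x + 1 / \<kappa> n) \<longlonglongrightarrow> x" by simp
qed simp

text \<open>The limit \<open>x powr (- S)\<close> of ratios of \<open>Q\<close> obeys the bound from
  \<open>Q_dom\<close>, which for small \<open>x\<close> excludes any larger
  \<open>S\<close>.\<close>

lemma S_le: "S \<le> 1 - 1 / C"
proof (rule ccontr)
  assume neg: "\<not> S \<le> 1 - 1 / C"
  define t where "t = S - (1 - 1 / C)"
  have t: "t > 0" using neg by (simp add: t_def)
  have C0: "C > 0" using C_ge_1 by simp
  \<comment> \<open>Solves \<open>x powr (- t) = 2 * C + 1\<close>, just above the permitted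
    \<open>2 * C\<close>.\<close>
  define x where "x = (2 * C + 1) powr (- 1 / t)"
  have x: "x > 0" using C0 by (simp add: x_def)
  have x1: "x \<le> 1"
    using C0 t powr_mono[of "- 1 / t" 0 "2 * C + 1"] by (simp add: x_def)
  have "(\<lambda>n. Q (nat \<lceil>x * \<kappa> n\<rceil>) / Q (\<kappa> n)) \<longlonglongrightarrow> x powr (- S)"
  proof (rule Q_ratio_limit[OF x _ ceiling_ratio_limit[OF x]])
    fix n
    have "x * \<kappa> n \<le> 1 * real (\<kappa> n)" using x1 by (intro mult_right_mono) auto
    then show "nat \<lceil>x * \<kappa> n\<rceil> \<le> \<kappa> n" by linarith
  qed
  moreover have "eventually (\<lambda>n. Q (nat \<lceil>x * \<kappa> n\<rceil>) / Q (\<kappa> n) \<le> 2 * C * x powr (1 / C - 1)) sequentially"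
    using eventually_kappa_ge[of 1]
  proof eventually_elim
    case (elim n)
    have "x * \<kappa> n \<le> 1 * real (\<kappa> n)" using x1 by (intro mult_right_mono) auto
    then have le: "nat \<lceil>x * \<kappa> n\<rceil> \<le> \<kappa> n" by linarith
    have "x * \<kappa> n > 0" using x elim by simp
    then have ge: "1 \<le> nat \<lceil>x * \<kappa> n\<rceil>" by linarith
    have "Q (nat \<lceil>x * \<kappa> n\<rceil>) \<le> 2 * C * Q (\<kappa> n) * (nat \<lceil>x * \<kappa> n\<rceil> / \<kappa> n) powr (1 / C - 1)"
      by (rule Q_dom[OF ge le])
    also have "\<dots> \<le> 2 * C * Q (\<kappa> n) * x powr (1 / C - 1)"
    proof (intro mult_left_mono powr_mono2')
      show "x \<le> nat \<lceil>x * \<kappa> n\<rceil> / \<kappa> n" using elim by (simp add: le_divide_eq real_nat_ceiling_ge)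
    qed (use x C_ge_1 Q_nonneg in auto)
    finally show ?case using Q_pos[of "\<kappa> n"] elim by (simp add: field_simps)
  qed
  ultimately have "x powr (- S) \<le> 2 * C * x powr (1 / C - 1)"
    by (rule tendsto_upperbound) simp
  moreover have "x powr (- S) = x powr (- t) * x powr (1 / C - 1)"
    by (simp add: t_def powr_add[symmetric])
  ultimately have "x powr (- t) \<le> 2 * C" using x by simp
  moreover have "x powr (- t) = 2 * C + 1" using t C0 by (simp add: x_def powr_powr)
  ultimately show False by simp
qed

lemma S_less_1: "S < 1"
  using S_le C_ge_1 by (smt (verit) divide_pos_pos)

text \<open>Replacing \<open>e i\<close> by \<open>S\<close> is harmless. Indices within
  \<open>\<rho> * k\<close> of either end contribute at most order
  \<open>\<rho> powr (1 / C)\<close> by \<open>A_dom\<close>; in between the weights are at most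
  \<open>D * (Q k)\<^sup>2\<close>, and the mean deviation tends to 0.\<close>

lemma error_term: "(\<lambda>n. (\<Sum>i=1..<\<kappa> n. \<bar>e i - S\<bar> * (Q i * Q (\<kappa> n - i))) / (\<kappa> n * (Q (\<kappa> n))\<^sup>2)) \<longlonglongrightarrow> 0"
proof (rule tendsto_0_tradeoff[OF mean, where d = "1 / C" and K = "8 * C\<^sup>2 * (M + \<bar>S\<bar>)"])
  have C0: "C > 0" using C_ge_1 by simp
  then show "1 / C > 0" by simp
  show "8 * C\<^sup>2 * (M + \<bar>S\<bar>) \<ge> 0" using M_pos by simp
  show "(\<Sum>i=1..<\<kappa> n. \<bar>e i - S\<bar> * (Q i * Q (\<kappa> n - i))) / (\<kappa> n * (Q (\<kappa> n))\<^sup>2) \<ge> 0" for n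
    by (intro divide_nonneg_nonneg sum_nonneg mult_nonneg_nonneg Q_nonneg) auto
  fix \<rho> :: real assume \<rho>: "0 < \<rho>" "\<rho> < 1/2"
  define D where "D = (2 * C * \<rho> powr (1 / C - 1))\<^sup>2"
  have ex: "eventually (\<lambda>n. (\<Sum>i=1..<\<kappa> n. \<bar>e i - S\<bar> * (Q i * Q (\<kappa> n - i))) / (\<kappa> n * (Q (\<kappa> n))\<^sup>2) \<le>
      8 * C\<^sup>2 * (M + \<bar>S\<bar>) * \<rho> powr (1 / C) + D * ((\<Sum>i=1..<\<kappa> n. \<bar>e i - S\<bar>) / \<kappa> n)) sequentially"
    using eventually_kappa_ge[of 2]
  proof eventually_elim
    case (elim n)
    define k where "k = \<kappa> n"
    have k: "k \<ge> 2" using elim by (simp add: k_def)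
    have Qk: "Q k > 0" using Q_pos k by simp
    define j where "j = nat \<lfloor>\<rho> * k\<rfloor>"
    have j: "real j \<le> \<rho> * k" using \<rho> by (simp add: j_def)
    have jk: "2 * j \<le> k" using j \<rho> mult_right_mono[of \<rho> "1/2" "real k"] by (simp add: field_simps)
    have j_iff: "i \<le> j" if "real i \<le> \<rho> * k" for i :: nat
      using that by (simp add: j_def le_nat_iff le_floor_iff)
    have Aj: "A j \<le> 2 * C * k * Q k * \<rho> powr (1 / C)"
    proof (cases "j = 0")
      case True
      then show ?thesis using C0 Q_nonneg by (simp add: A_def)
    next
      case False
      have "A j \<le> 2 * C * k * Q k * (j / k) powr (1 / C)"
        using False jk by (intro A_dom) auto
      also have "\<dots> \<le> 2 * C * k * Q k * \<rho> powr (1 / C)"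
        using C0 Q_nonneg j k by (intro mult_left_mono powr_mono2) (auto simp: field_simps)
      finally show ?thesis .
    qed
    have ebound: "\<bar>e i - S\<bar> \<le> M + \<bar>S\<bar>" if "i \<ge> 1" for i
      using e_le[OF that] e_pos[OF that] by linarith
    define a where "a = (M + \<bar>S\<bar>) * (2 * C * Q k)"
    have a: "a \<ge> 0" using M_pos C0 Qk by (simp add: a_def)
    \<comment> \<open>Here \<open>l\<close> is the index near an end and \<open>m\<close> the
      complementary one, at least \<open>k / 2\<close>; \<open>i\<close> will be either of the
      two.\<close>
    have edge: "\<bar>e i - S\<bar> * (Q l * Q m) \<le> a * Q l" if "i \<ge> 1" "l + m = k" "real l \<le> \<rho> * k" "1 \<le> m" for i l m
    proof -
      have "k \<le> 2 * m" using j_iff[OF that(3)] jk that(2) by linarith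
      then have "Q m \<le> 2 * C * Q k" using that by (intro Q_half) auto
      then have "\<bar>e i - S\<bar> * (Q m * Q l) \<le> (M + \<bar>S\<bar>) * (2 * C * Q k * Q l)"
        using ebound[OF that(1)] Q_nonneg M_pos C0 by (intro mult_mono mult_right_mono) auto
      then show ?thesis by (simp add: a_def mult_ac)
    qed
    have mid: "Q l \<le> (2 * C * \<rho> powr (1 / C - 1)) * Q k" if "real l > \<rho> * k" "l \<le> k" for l
    proof -
      have "\<rho> * k > 0" using \<rho> k by simp
      then have "l \<ge> 1" using that by (cases l) auto
      then have "Q l \<le> 2 * C * Q k * (l / k) powr (1 / C - 1)" using that by (intro Q_dom) auto
      also have "\<dots> \<le> 2 * C * Q k * \<rho> powr (1 / C - 1)"
        using that \<rho> C_ge_1 Q_nonneg k by (intro mult_left_mono powr_mono2') (auto simp: field_simps)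
      finally show ?thesis by (simp add: mult_ac)
    qed
    have "(\<Sum>i=1..<k. \<bar>e i - S\<bar> * (Q i * Q (k - i))) \<le>
      (\<Sum>i=1..<k. (if i \<le> j then a * Q i else 0) + (if k - i \<le> j then a * Q (k - i) else 0) + D * (Q k)\<^sup>2 * \<bar>e i - S\<bar>)"
    proof (intro sum_mono)
      fix i assume i: "i \<in> {1..<k}"
      have nn: "a * Q i \<ge> 0" "a * Q (k - i) \<ge> 0" "D * (Q k)\<^sup>2 * \<bar>e i - S\<bar> \<ge> 0"
        using a Q_nonneg by (auto simp: D_def)
      consider "real i \<le> \<rho> * k" | "real (k - i) \<le> \<rho> * k" | "real i > \<rho> * k" "real (k - i) > \<rho> * k" by linarith
      then show "\<bar>e i - S\<bar> * (Q i * Q (k - i)) \<le>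
        (if i \<le> j then a * Q i else 0) + (if k - i \<le> j then a * Q (k - i) else 0) + D * (Q k)\<^sup>2 * \<bar>e i - S\<bar>"
      proof cases
        case 1
        have "\<bar>e i - S\<bar> * (Q i * Q (k - i)) \<le> a * Q i" using i 1 by (intro edge) auto
        then show ?thesis using j_iff[OF 1] nn by auto
      next
        case 2
        have "\<bar>e i - S\<bar> * (Q (k - i) * Q i) \<le> a * Q (k - i)" using i 2 by (intro edge) auto
        then show ?thesis using j_iff[OF 2] nn by (auto simp: mult.commute)
      next
        case 3
        have "Q i * Q (k - i) \<le> ((2 * C * \<rho> powr (1 / C - 1)) * Q k) * ((2 * C * \<rho> powr (1 / C - 1)) * Q k)"
          using 3 i C0 Q_nonneg by (intro mult_mono mid) auto
        also have "\<dots> = D * (Q k)\<^sup>2" by (simp add: D_def power2_eq_square mult_ac)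
        finally have "\<bar>e i - S\<bar> * (Q i * Q (k - i)) \<le> \<bar>e i - S\<bar> * (D * (Q k)\<^sup>2)" by (intro mult_left_mono) auto
        then have "\<bar>e i - S\<bar> * (Q i * Q (k - i)) \<le> D * (Q k)\<^sup>2 * \<bar>e i - S\<bar>" by (simp add: mult.commute)
        then show ?thesis using nn by auto
      qed
    qed
    also have "\<dots> = (\<Sum>i=1..<k. if i \<le> j then a * Q i else 0) + (\<Sum>i=1..<k. if k - i \<le> j then a * Q (k - i) else 0)
        + D * (Q k)\<^sup>2 * (\<Sum>i=1..<k. \<bar>e i - S\<bar>)"
      by (simp add: sum.distrib sum_distrib_left)
    also have "(\<Sum>i=1..<k. if k - i \<le> j then a * Q (k - i) else 0) = (\<Sum>i=1..<k. if i \<le> j then a * Q i else 0)"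
      by (rule sum_flip[of "\<lambda>i l. if l \<le> j then a * Q l else 0" k])
    also have "(\<Sum>i=1..<k. if i \<le> j then a * Q i else 0) = (\<Sum>i=1..j. a * Q i)"
      using jk k by (intro sum.mono_neutral_cong_right) auto
    also have "(\<Sum>i=1..j. a * Q i) = a * A j" by (simp add: A_def sum_distrib_left)
    also have "a * A j + a * A j + D * (Q k)\<^sup>2 * (\<Sum>i=1..<k. \<bar>e i - S\<bar>) \<le>
        a * (2 * C * k * Q k * \<rho> powr (1 / C)) + a * (2 * C * k * Q k * \<rho> powr (1 / C)) + D * (Q k)\<^sup>2 * (\<Sum>i=1..<k. \<bar>e i - S\<bar>)"
      using a Aj by (intro add_mono mult_left_mono order_refl) auto
    also have "\<dots> = (8 * C\<^sup>2 * (M + \<bar>S\<bar>) * \<rho> powr (1 / C) + D * ((\<Sum>i=1..<k. \<bar>e i - S\<bar>) / k)) * (k * (Q k)\<^sup>2)"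
      using k by (simp add: a_def power2_eq_square algebra_simps)
    finally show ?case
      unfolding k_def[symmetric] using Qk k by (simp add: pos_divide_le_eq)
  qed
  show "\<exists>K'. eventually (\<lambda>n. (\<Sum>i=1..<\<kappa> n. \<bar>e i - S\<bar> * (Q i * Q (\<kappa> n - i))) / (\<kappa> n * (Q (\<kappa> n))\<^sup>2) \<le>
      8 * C\<^sup>2 * (M + \<bar>S\<bar>) * \<rho> powr (1 / C) + K' * ((\<Sum>i=1..<\<kappa> n. \<bar>e i - S\<bar>) / \<kappa> n)) sequentially"
    by (rule exI[of _ D], rule ex)
qed

text \<open>All \<open>e i\<close> are at least \<open>q 1\<close>, so a smaller \<open>S\<close>
  would keep the mean deviation away from 0.\<close>

lemma S_ge: "q 1 \<le> S"
proof (rule ccontr)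
  assume "\<not> q 1 \<le> S"
  then have S: "S < q 1" by simp
  have "eventually (\<lambda>n. (q 1 - S) / 2 \<le> (\<Sum>i=1..<\<kappa> n. \<bar>e i - S\<bar>) / \<kappa> n) sequentially"
    using eventually_kappa_ge[of 2]
  proof eventually_elim
    case (elim n)
    have "(q 1 - S) / 2 * \<kappa> n \<le> (q 1 - S) * real (\<kappa> n - 1)"
    proof -
      have "(q 1 - S) * (real (\<kappa> n) / 2) \<le> (q 1 - S) * real (\<kappa> n - 1)"
        using S elim by (intro mult_left_mono) auto
      then show ?thesis by simp
    qed
    also have "\<dots> = (\<Sum>i=1..<\<kappa> n. q 1 - S)" by simp
    also have "\<dots> \<le> (\<Sum>i=1..<\<kappa> n. \<bar>e i - S\<bar>)"
    proof (intro sum_mono)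
      fix i assume "i \<in> {1..<\<kappa> n}"
      then show "q 1 - S \<le> \<bar>e i - S\<bar>" using e_ge[of i] by auto
    qed
    finally show ?case using elim by (simp add: pos_le_divide_eq)
  qed
  then have "(q 1 - S) / 2 \<le> 0"
    by (rule tendsto_lowerbound[OF mean]) simp
  with S show False by simp
qed

text \<open>A Riemann sum for the Beta integral: the quotient is the integral of a step function
  \<open>f n\<close> that converges pointwise by \<open>Q_ratio_limit\<close> and is dominated by
  means of \<open>Q_dom\<close>.\<close>

lemma c_limit: "(\<lambda>n. c (\<kappa> n - 1) / (\<kappa> n * (Q (\<kappa> n))\<^sup>2)) \<longlonglongrightarrow> Beta (1 - S) (1 - S)"
proof -
  have C0: "C > 0" using C_ge_1 by simp
  have S1: "S < 1" by (rule S_less_1)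
  define F where "F k i = Q i * Q (k - i) / (Q k)\<^sup>2" for k i
  define f where "f n x = (\<Sum>i=1..<\<kappa> n. F (\<kappa> n) i * indicator {(real i - 1) / \<kappa> n<..i / \<kappa> n} x)" for n and x :: real
  define g where "g x = indicator {0..1} x * (x powr (1 - S - 1) * (1 - x) powr (1 - S - 1))" for x :: real
  \<comment> \<open>The bounds for \<open>Q j\<close> and \<open>Q (k - j)\<close> carry the
    constants \<open>2 * C\<close> and \<open>4 * C\<close>, hence
    \<open>8 * C\<^sup>2\<close>.\<close>
  define w where "w x = 8 * C\<^sup>2 * (indicator {0..1} x * (x powr (1 / C - 1) * (1 - x) powr (1 / C - 1)))" for x :: real
  have f_outside: "f n x = 0" if "x \<le> 0 \<or> x \<ge> 1" for n x
    unfolding f_def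
  proof (intro sum.neutral ballI)
    fix i assume i: "i \<in> {1..<\<kappa> n}"
    have "x \<notin> {(real i - 1) / \<kappa> n<..i / \<kappa> n}"
    proof (cases "x \<le> 0")
      case True
      have "(real i - 1) / \<kappa> n \<ge> 0" using i by simp
      then show ?thesis using True by auto
    next
      case False
      have "real i / \<kappa> n < 1" using i by simp
      then show ?thesis using that False by auto
    qed
    then show "F (\<kappa> n) i * indicator {(real i - 1) / \<kappa> n<..i / \<kappa> n} x = 0" by simp
  qed
  have pointwise: "(\<lambda>n. f n x) \<longlonglongrightarrow> g x" for x
  proof (cases "0 < x \<and> x < 1")
    case False
    then have "f n x = 0" for n using f_outside[of x n] by linarith
    \<comment> \<open>At the end points this rests on \<open>0 powr a = 0\<close>.\<close>
    moreover have "g x = 0" using False by (cases "x = 0 \<or> x = 1") (auto simp: g_def indicator_def)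
    ultimately show ?thesis by simp
  next
    case True
    define j where "j n = nat \<lceil>x * \<kappa> n\<rceil>" for n
    have j_le: "j n \<le> \<kappa> n" for n
    proof -
      have "x * \<kappa> n \<le> 1 * real (\<kappa> n)" using True by (intro mult_right_mono) auto
      then show ?thesis unfolding j_def by linarith
    qed
    have jlim: "(\<lambda>n. j n / \<kappa> n) \<longlonglongrightarrow> x"
      unfolding j_def using True by (intro ceiling_ratio_limit) auto
    have "(\<lambda>n. 1 - j n / \<kappa> n) \<longlonglongrightarrow> 1 - x" by (intro tendsto_intros jlim)
    moreover have "eventually (\<lambda>n. 1 - j n / \<kappa> n = real (\<kappa> n - j n) / \<kappa> n) sequentially"
      using eventually_kappa_ge[of 1]
      by eventually_elim (use j_le in \<open>simp add: of_nat_diff diff_divide_distrib\<close>)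
    ultimately have jlim': "(\<lambda>n. real (\<kappa> n - j n) / \<kappa> n) \<longlonglongrightarrow> 1 - x"
      by (simp add: tendsto_cong)
    have "(\<lambda>n. Q (j n) / Q (\<kappa> n) * (Q (\<kappa> n - j n) / Q (\<kappa> n))) \<longlonglongrightarrow> x powr (- S) * (1 - x) powr (- S)"
      using True j_le by (intro tendsto_mult Q_ratio_limit jlim jlim') auto
    moreover have "eventually (\<lambda>n. Q (j n) / Q (\<kappa> n) * (Q (\<kappa> n - j n) / Q (\<kappa> n)) = f n x) sequentially"
    proof -
      have "eventually (\<lambda>n. j n / \<kappa> n < 1) sequentially"
        using jlim True by (intro order_tendstoD) auto
      with eventually_kappa_ge[of 1] show ?thesis
      proof eventually_elim
        case (elim n)
        then have "j n < \<kappa> n" by simp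
        moreover have "f n x = (if nat \<lceil>x * \<kappa> n\<rceil> < \<kappa> n then F (\<kappa> n) (nat \<lceil>x * \<kappa> n\<rceil>) else 0)"
          unfolding f_def by (rule sum_indicator_cell) (use True elim in auto)
        ultimately show ?case by (simp add: F_def j_def power2_eq_square)
      qed
    qed
    ultimately have "(\<lambda>n. f n x) \<longlonglongrightarrow> x powr (- S) * (1 - x) powr (- S)"
      by (rule Lim_transform_eventually)
    then show ?thesis using True by (simp add: g_def)
  qed
  have dominated: "norm (f n x) \<le> w x" for n x
  proof (cases "0 < x \<and> x < 1 \<and> \<kappa> n > 0")
    case False
    then have "f n x = 0" using f_outside[of x n] by (auto simp: f_def not_less)
    then show ?thesis by (simp add: w_def)
  next
    case True
    define k where "k = \<kappa> n"
    define j where "j = nat \<lceil>x * k\<rceil>"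
    have fn: "f n x = (if j < k then F k j else 0)"
      unfolding f_def j_def k_def using True by (intro sum_indicator_cell) auto
    show ?thesis
    proof (cases "j < k")
      case False
      then show ?thesis using fn by (simp add: w_def)
    next
      case jk: True
      have xk: "x * k > 0" using True by (simp add: k_def)
      have j: "j \<ge> 1" "x * k \<le> j" "j < x * k + 1" using xk unfolding j_def by linarith+
      have k: "k > 0" using True by (simp add: k_def)
      have Qk: "Q k > 0" using Q_pos k by simp
      have "Q j \<le> 2 * C * Q k * (j / k) powr (1 / C - 1)" using j jk by (intro Q_dom) auto
      also have "\<dots> \<le> 2 * C * Q k * x powr (1 / C - 1)"
        using True j k C_ge_1 Qk by (intro mult_left_mono powr_mono2') (auto simp: pos_le_divide_eq)
      finally have 1: "Q j \<le> 2 * C * x powr (1 / C - 1) * Q k" by (simp add: mult_ac)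
      have "Q (k - j) \<le> 2 * C * Q k * (real (k - j) / k) powr (1 / C - 1)" using j jk by (intro Q_dom) auto
      also have "\<dots> \<le> 2 * C * Q k * ((1 - x) / 2) powr (1 / C - 1)"
      proof (intro mult_left_mono powr_mono2')
        \<comment> \<open>Rounding up makes \<open>k - j\<close> fall short of
          \<open>(1 - x) * k\<close> by less than 1; as \<open>k - j \<ge> 1\<close>, this costs at
          most a factor 2.\<close>
        have "real (k - j) = real k - j" using jk by simp
        moreover have "real (k - j) \<ge> 1" using jk by simp
        ultimately have "(1 - x) * k \<le> 2 * real (k - j)" using j by (simp add: algebra_simps)
        then show "(1 - x) / 2 \<le> real (k - j) / k" using k by (simp add: field_simps)
      qed (use True C_ge_1 Qk in auto)
      also have "((1 - x) / 2) powr (1 / C - 1) = (1 - x) powr (1 / C - 1) * 2 powr (1 - 1 / C)"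
        using True by (simp add: powr_divide powr_diff field_simps)
      also have "2 * C * Q k * ((1 - x) powr (1 / C - 1) * 2 powr (1 - 1 / C)) \<le>
          2 * C * Q k * ((1 - x) powr (1 / C - 1) * 2)"
        using C0 Qk powr_mono[of "1 - 1 / C" 1 2] by (intro mult_left_mono) auto
      finally have 2: "Q (k - j) \<le> 4 * C * (1 - x) powr (1 / C - 1) * Q k" by (simp add: mult_ac)
      have "Q j * Q (k - j) \<le> (2 * C * x powr (1 / C - 1) * Q k) * (4 * C * (1 - x) powr (1 / C - 1) * Q k)"
        using 1 2 C0 Qk Q_nonneg by (intro mult_mono) auto
      also have "\<dots> = w x * (Q k)\<^sup>2"
        using True by (simp add: w_def power2_eq_square mult_ac)
      finally have "F k j \<le> w x"
        using Qk by (simp add: F_def pos_divide_le_eq)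
      moreover have "F k j \<ge> 0" using Q_nonneg by (simp add: F_def)
      ultimately show ?thesis using fn jk by simp
    qed
  qed
  have meas: "f n \<in> borel_measurable lborel" for n
    unfolding f_def by measurable
  have w_int: "integrable lborel w"
    using integrable_Beta[of "1 / C" "1 / C"] C0 unfolding w_def set_integrable_def by simp
  have g_meas: "g \<in> borel_measurable lborel" unfolding g_def by measurable
  have conv: "(\<lambda>n. integral\<^sup>L lborel (f n)) \<longlonglongrightarrow> integral\<^sup>L lborel g"
    by (rule integral_dominated_convergence[OF g_meas meas w_int]) (intro AE_I2 pointwise dominated)+
  have "integral\<^sup>L lborel g = Beta (1 - S) (1 - S)"
  proof -
    have "set_integrable lborel {0..1} (\<lambda>t. t powr (1 - S - 1) * (1 - t) powr (1 - S - 1))"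
      using S1 by (intro integrable_Beta) auto
    then have "(LINT t:{0..1}|lborel. t powr (1 - S - 1) * (1 - t) powr (1 - S - 1)) =
        integral {0..1} (\<lambda>t. t powr (1 - S - 1) * (1 - t) powr (1 - S - 1))"
      by (rule set_borel_integral_eq_integral)
    also have "\<dots> = Beta (1 - S) (1 - S)"
      using S1 by (intro integral_unique has_integral_Beta_real) auto
    finally show ?thesis unfolding g_def set_lebesgue_integral_def by simp
  qed
  moreover have "eventually (\<lambda>n. integral\<^sup>L lborel (f n) = c (\<kappa> n - 1) / (\<kappa> n * (Q (\<kappa> n))\<^sup>2)) sequentially"
    using eventually_kappa_ge[of 1]
  proof eventually_elim
    case (elim n)
    define k where "k = \<kappa> n"
    have k: "k \<ge> 1" using elim by (simp add: k_def)
    have ind: "integrable lborel (indicat_real {a<..b})" for a b :: real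
      by (intro integrable_real_indicator emeasure_bounded_finite)
         (auto intro: bounded_subset[OF bounded_closed_interval[of a b]])
    have "integral\<^sup>L lborel (f n) = (\<Sum>i=1..<k. F k i * measure lborel {(real i - 1) / k<..i / k})"
      unfolding f_def k_def[symmetric] by (subst Bochner_Integration.integral_sum) (auto simp: ind)
    also have "\<dots> = (\<Sum>i=1..<k. F k i * (1 / k))"
    proof (intro sum.cong refl)
      fix i
      have "(real i - 1) / k \<le> real i / k" by (intro divide_right_mono) auto
      then have "measure lborel {(real i - 1) / k<..i / k} = i / k - (real i - 1) / k" by simp
      also have "\<dots> = 1 / k" by (simp add: diff_divide_distrib)
      finally show "F k i * measure lborel {(real i - 1) / k<..i / k} = F k i * (1 / k)" by simp
    qed
    also have "\<dots> = (\<Sum>i=1..<k. Q i * Q (k - i)) / (k * (Q k)\<^sup>2)"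
      by (simp add: F_def sum_divide_distrib mult.commute)
    also have "(\<Sum>i=1..<k. Q i * Q (k - i)) = c (k - 1)"
    proof -
      have "{1..<k} = {1..k - 1}" "Suc (k - 1) = k" using k by auto
      then show ?thesis unfolding c_def by simp
    qed
    finally show ?case by (simp add: k_def)
  qed
  ultimately show ?thesis
    using Lim_transform_eventually[OF conv] by simp
qed

text \<open>The centred sum \<open>E\<close> tends to 0 by \<open>error_term\<close>, while
  \<open>conv_eQQ\<close> and \<open>c_limit\<close> compute its limit in terms of \<open>S\<close>;
  the two values must agree.\<close>

lemma exponent_eq: "(2 * S - 1) * Beta (1 - S) (1 - S) = \<theta>"
proof -
  define E where "E n = (\<Sum>i=1..<\<kappa> n. (e i - S) * (Q i * Q (\<kappa> n - i))) / (\<kappa> n * (Q (\<kappa> n))\<^sup>2)" for n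
  have "E \<longlonglongrightarrow> 0"
  proof (rule Lim_null_comparison[OF _ error_term])
    show "eventually (\<lambda>n. norm (E n) \<le>
        (\<Sum>i=1..<\<kappa> n. \<bar>e i - S\<bar> * (Q i * Q (\<kappa> n - i))) / (\<kappa> n * (Q (\<kappa> n))\<^sup>2)) sequentially"
    proof (intro always_eventually allI)
      fix n
      have "norm (E n) = \<bar>\<Sum>i=1..<\<kappa> n. (e i - S) * (Q i * Q (\<kappa> n - i))\<bar> / (\<kappa> n * (Q (\<kappa> n))\<^sup>2)"
        by (simp add: E_def)
      also have "\<dots> \<le> (\<Sum>i=1..<\<kappa> n. \<bar>(e i - S) * (Q i * Q (\<kappa> n - i))\<bar>) / (\<kappa> n * (Q (\<kappa> n))\<^sup>2)"
        by (intro divide_right_mono sum_abs) auto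
      finally show "norm (E n) \<le> (\<Sum>i=1..<\<kappa> n. \<bar>e i - S\<bar> * (Q i * Q (\<kappa> n - i))) / (\<kappa> n * (Q (\<kappa> n))\<^sup>2)"
        by (simp add: abs_mult Q_nonneg)
    qed
  qed
  moreover have "E \<longlonglongrightarrow> (1/2 - S) * Beta (1 - S) (1 - S) + \<theta> / 2 * (1 - 0)"
  proof (rule Lim_transform_eventually)
    show "(\<lambda>n. (1/2 - S) * (c (\<kappa> n - 1) / (\<kappa> n * (Q (\<kappa> n))\<^sup>2)) + \<theta> / 2 * (1 - 1 / \<kappa> n))
        \<longlonglongrightarrow> (1/2 - S) * Beta (1 - S) (1 - S) + \<theta> / 2 * (1 - 0)"
      by (intro tendsto_intros c_limit real_tendsto_divide_at_top[OF tendsto_const real_kappa_top])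
    show "eventually (\<lambda>n. (1/2 - S) * (c (\<kappa> n - 1) / (\<kappa> n * (Q (\<kappa> n))\<^sup>2)) + \<theta> / 2 * (1 - 1 / \<kappa> n) = E n) sequentially"
      using eventually_kappa_ge[of 2]
    proof eventually_elim
      case (elim n)
      define k where "k = \<kappa> n"
      have k: "k \<ge> 2" using elim by (simp add: k_def)
      have Qk: "Q k > 0" using Q_pos k by simp
      have cc: "(\<Sum>i=1..<k. Q i * Q (k - i)) = c (k - 1)"
      proof -
        have "{1..<k} = {1..k - 1}" "Suc (k - 1) = k" using k by auto
        then show ?thesis unfolding c_def by simp
      qed
      have "(\<Sum>i=1..<k. (e i - S) * (Q i * Q (k - i))) = (\<Sum>i=1..<k. e i * (Q i * Q (k - i))) - S * c (k - 1)"
        by (simp only: left_diff_distrib sum_subtractf sum_distrib_left[symmetric] cc)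
      also have "\<dots> = (1/2 - S) * c (k - 1) + real (k - 1) / 2 * \<theta> * (Q k)\<^sup>2"
        by (simp only: conv_eQQ[OF k]) (simp add: algebra_simps)
      finally have "E n = ((1/2 - S) * c (k - 1) + real (k - 1) / 2 * \<theta> * (Q k)\<^sup>2) / (k * (Q k)\<^sup>2)"
        by (simp only: E_def k_def)
      also have "\<dots> = (1/2 - S) * (c (k - 1) / (k * (Q k)\<^sup>2)) + \<theta> / 2 * (1 - 1 / k)"
        using k Qk by (simp add: of_nat_diff field_simps)
      finally show ?case by (simp only: k_def)
    qed
  qed
  ultimately have "(1/2 - S) * Beta (1 - S) (1 - S) + \<theta> / 2 * (1 - 0) = 0"
    by (rule LIMSEQ_unique[symmetric])
  then show ?thesis by (simp add: algebra_simps)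
qed

end

section \<open>Convergence of the local exponent and slow variation of the tail\<close>

text \<open>Taking \<sigma> = 1 and \<sigma> = -1, the upper and lower limits both lie in (1/2, 1)
  and solve the same equation, so \<open>Beta_char_inj\<close> identifies them.\<close>

lemma e_converges:
  obtains \<beta> where "1/2 < \<beta>" "\<beta> < 1" "(2 * \<beta> - 1) * Beta (1 - \<beta>) (1 - \<beta>) = \<theta>" "e \<longlonglongrightarrow> \<beta>"
proof -
  have bound: "\<bar>\<sigma> * e k\<bar> \<le> M" if "1 \<le> k" "\<bar>\<sigma>\<bar> = 1" for \<sigma> k
    using e_pos[OF that(1)] e_le[OF that(1)] that(2) by (simp add: abs_mult)
  have ext: "\<exists>L. (\<forall>\<eta>>0. eventually (\<lambda>k. \<sigma> * e k < L + \<eta>) sequentially) \<and> 1/2 < \<sigma> * L \<and> \<sigma> * L < 1 \<and>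
      (2 * (\<sigma> * L) - 1) * Beta (1 - \<sigma> * L) (1 - \<sigma> * L) = \<theta>" if \<sigma>: "\<bar>\<sigma>\<bar> = 1" for \<sigma> :: real
  proof -
    obtain L where up: "\<And>\<eta>. \<eta> > 0 \<Longrightarrow> eventually (\<lambda>k. \<sigma> * e k < L + \<eta>) sequentially"
      and low: "\<And>\<eta> N. \<eta> > 0 \<Longrightarrow> \<exists>k\<ge>N. \<sigma> * e k > L - \<eta>"
      using bounded_limsup[of "\<lambda>k. \<sigma> * e k" M] bound[OF _ \<sigma>] by blast
    obtain \<kappa> where \<kappa>: "filterlim \<kappa> at_top sequentially"
      "(\<lambda>n. (\<Sum>i=1..<\<kappa> n. \<bar>e i - \<sigma> * L\<bar>) / \<kappa> n) \<longlonglongrightarrow> 0"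
      using extremal_subsequence[OF \<sigma> up low] by blast
    show ?thesis
      using up S_ge[OF \<kappa>] S_less_1[OF \<kappa>] exponent_eq[OF \<kappa>] q_1 by (intro exI[of _ L]) auto
  qed
  obtain L where L: "\<And>\<eta>. \<eta> > 0 \<Longrightarrow> eventually (\<lambda>k. e k < L + \<eta>) sequentially"
    "1/2 < L" "L < 1" "(2 * L - 1) * Beta (1 - L) (1 - L) = \<theta>"
    using ext[of 1] by auto
  obtain L' where L': "\<And>\<eta>. \<eta> > 0 \<Longrightarrow> eventually (\<lambda>k. - e k < L' + \<eta>) sequentially"
    "1/2 < - L'" "- L' < 1" "(2 * (- L') - 1) * Beta (1 - (- L')) (1 - (- L')) = \<theta>"
    using ext[of "-1"] by auto
  have "L = - L'" using L L' by (intro Beta_char_inj[of L "- L'"]) auto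
  have "e \<longlonglongrightarrow> L"
  proof (rule order_tendstoI)
    fix a assume "a < L"
    then have "eventually (\<lambda>k. - e k < L' + (L - a)) sequentially" by (intro L') simp
    then show "eventually (\<lambda>k. a < e k) sequentially"
      by eventually_elim (use \<open>L = - L'\<close> in linarith)
  next
    fix a assume "L < a"
    then have "eventually (\<lambda>k. e k < L + (a - L)) sequentially" by (intro L) simp
    then show "eventually (\<lambda>k. e k < a) sequentially" by simp
  qed
  with L show ?thesis using that by blast
qed

text \<open>By \<open>ln_Q_step\<close>, \<open>n\<close> times the increment of the logarithm is
  \<open>\<beta> - e n\<close> up to order \<open>1 / n\<close>, which is the criterion of
  \<open>slowly_varying_floorI\<close>.\<close>

lemma Q_slowly_varying:
  assumes "e \<longlonglongrightarrow> \<beta>"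
  shows "slowly_varying (\<lambda>z. Q (nat \<lfloor>max 1 z\<rfloor>) * real (nat \<lfloor>max 1 z\<rfloor>) powr \<beta>)"
proof (rule slowly_varying_floorI[of "\<lambda>n. Q n * real n powr \<beta>"])
  show "0 < Q n * real n powr \<beta>" if "n \<ge> 1" for n using Q_pos that by simp
  define K where "K = 2 * M\<^sup>2 + 2 * \<bar>\<beta>\<bar>"
  have ev: "eventually (\<lambda>n. norm (n * (ln (Q (Suc n) * real (Suc n) powr \<beta>) - ln (Q n * real n powr \<beta>))) \<le>
      \<bar>e n - \<beta>\<bar> + K / n) sequentially"
    using eventually_ge_at_top[of 2] eventually_ge_at_top[of "nat \<lceil>2 * M\<rceil>"]
  proof eventually_elim
    case (elim n)
    then have n: "n \<ge> 2" "real n \<ge> 2 * M" by linarith+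
    have pos: "Q n > 0" "Q (Suc n) > 0" using Q_pos n by auto
    have "ln (Q (Suc n) * real (Suc n) powr \<beta>) - ln (Q n * real n powr \<beta>) =
        - (ln (Q n) - ln (Q (Suc n)) - \<beta> * (ln (Suc n) - ln n))"
      using pos n by (simp add: ln_mult ln_powr algebra_simps)
    then have "norm (n * (ln (Q (Suc n) * real (Suc n) powr \<beta>) - ln (Q n * real n powr \<beta>))) =
        n * \<bar>ln (Q n) - ln (Q (Suc n)) - \<beta> * (ln (Suc n) - ln n)\<bar>"
      by (simp only: real_norm_def abs_mult abs_minus_cancel)
    also have "\<dots> \<le> n * (\<bar>e n - \<beta>\<bar> / n + K / (real n)\<^sup>2)"
      unfolding K_def by (rule mult_left_mono[OF ln_Q_step[OF n]]) simp
    also have "\<dots> = \<bar>e n - \<beta>\<bar> + K / n" using n by (simp add: field_simps power2_eq_square)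
    finally show ?case .
  qed
  have "(\<lambda>n. \<bar>e n - \<beta>\<bar> + K / real n) \<longlonglongrightarrow> \<bar>\<beta> - \<beta>\<bar> + 0"
    by (intro tendsto_intros assms real_tendsto_divide_at_top[OF tendsto_const filterlim_real_sequentially])
  then have "(\<lambda>n. \<bar>e n - \<beta>\<bar> + K / real n) \<longlonglongrightarrow> 0" by simp
  with ev show "(\<lambda>n. real n * (ln (Q (Suc n) * real (Suc n) powr \<beta>) - ln (Q n * real n powr \<beta>))) \<longlonglongrightarrow> 0"
    by (rule Lim_null_comparison)
qed

end

section \<open>Application to the law of the tree\<close>

theorem theorem7p1:
  fixes p :: real
  assumes "0 < p" and "p < 1"
  shows "\<exists>\<phi> \<Phi>. slowly_varying \<phi> \<and> slowly_varying \<Phi> \<and>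
    (\<forall>k::nat. k \<ge> 1 \<longrightarrow>
       q_LIS p k = real k powr (- 1 / (2 * alpha p) - 1) * \<phi> (real k) \<and>
       Q_LIS p k = real k powr (- 1 / (2 * alpha p)) * \<Phi> (real k))"
proof -
  note p = assms
  define \<theta> where "\<theta> = (1 - p) / p"
  interpret lis_tail "q_LIS p" "Q_LIS p" \<theta>
  proof
    have eq: "1 - Q_LIS p (Suc 1) = q_LIS p 1"
      using Q_LIS_Suc[OF p, of 1] Q_LIS_1[OF p] by simp
    then have Q2: "Q_LIS p 2 = 1 - q_LIS p 1" by (simp add: numeral_2_eq_2)
    have q1: "q_LIS p 1 = 1/2 + (1 - p) / 2 * (q_LIS p 1)\<^sup>2"
      using q_LIS_rec[OF p, of 1] unfolding eq Q_LIS_1[OF p] by simp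
    \<comment> \<open>The quadratic equation first gives the weak bound 1/2, hence a nonzero value,
      hence a positive square term and the strict bound.\<close>
    have "(1 - p) / 2 * (q_LIS p 1)\<^sup>2 \<ge> 0" using p by simp
    then have "q_LIS p 1 \<noteq> 0" using q1 by linarith
    then have "(1 - p) / 2 * (q_LIS p 1)\<^sup>2 > 0" using p by simp
    then show "q_LIS p 1 > 1/2" using q1 by linarith
    have "2 * q_LIS p 1 = 1 + (1 - p) * (q_LIS p 1)\<^sup>2" using q1 by (simp add: field_simps)
    then have "p * q_LIS p 1 = p * Q_LIS p 2 + (1 - p) * (Q_LIS p 2)\<^sup>2"
      unfolding Q2 by (simp add: power2_eq_square algebra_simps)
    then show "q_LIS p 1 = Q_LIS p 2 + \<theta> * (Q_LIS p 2)\<^sup>2"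
      using p by (simp add: \<theta>_def field_simps)
    show "\<theta> > 0" using p by (simp add: \<theta>_def)
    show "(\<Sum>i=1..<k. q_LIS p i * q_LIS p (k - i)) = q_LIS p k * (2 + \<theta> * (Q_LIS p k + Q_LIS p (Suc k)))"
      if "k \<ge> 2" for k
    proof -
      define X where "X = (\<Sum>i=1..<k. q_LIS p i * q_LIS p (k - i))"
      have "q_LIS p k = p / 2 * X + (1 - p) / 2 * ((1 - Q_LIS p (Suc k))\<^sup>2 - (1 - Q_LIS p k)\<^sup>2)"
        using q_LIS_rec[OF p, of k] that by (simp add: X_def)
      also have "(1 - Q_LIS p (Suc k))\<^sup>2 - (1 - Q_LIS p k)\<^sup>2 = q_LIS p k * (2 - (Q_LIS p k + Q_LIS p (Suc k)))"
        unfolding Q_LIS_Suc[OF p, of k] by (simp add: power2_eq_square algebra_simps)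
      finally have "p * X = q_LIS p k * (2 * p + (1 - p) * (Q_LIS p k + Q_LIS p (Suc k)))"
        by (simp add: field_simps)
      also have "\<dots> = p * (q_LIS p k * (2 + \<theta> * (Q_LIS p k + Q_LIS p (Suc k))))"
        using p by (simp add: \<theta>_def field_simps)
      finally show ?thesis using p by (simp add: X_def)
    qed
  qed (rule Q_LIS_1[OF p] Q_LIS_Suc[OF p] Q_LIS_nonneg[OF p])+
  obtain \<beta> where \<beta>: "1/2 < \<beta>" "\<beta> < 1" "(2 * \<beta> - 1) * Beta (1 - \<beta>) (1 - \<beta>) = \<theta>" "e \<longlonglongrightarrow> \<beta>"
    by (rule e_converges)
  have "alpha p = 1 / (2 * \<beta>)"
    using \<beta> by (intro alpha_eqI p) (auto simp: \<theta>_def)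
  then have exponent: "- 1 / (2 * alpha p) = - \<beta>" by simp
  define \<Phi> where "\<Phi> z = Q_LIS p (nat \<lfloor>max 1 z\<rfloor>) * real (nat \<lfloor>max 1 z\<rfloor>) powr \<beta>" for z :: real
  \<comment> \<open>The factor \<open>e\<close> comes from \<open>q k = e k * Q k / k\<close>; the
    division by \<open>k\<close> accounts for the additional -1 in the exponent.\<close>
  define \<phi> where "\<phi> z = e (nat \<lfloor>max 1 z\<rfloor>) * (Q_LIS p (nat \<lfloor>max 1 z\<rfloor>) * real (nat \<lfloor>max 1 z\<rfloor>) powr \<beta>)" for z :: real
  have "slowly_varying \<Phi>"
    unfolding \<Phi>_def[abs_def] by (rule Q_slowly_varying[OF \<beta>(4)])
  moreover have "slowly_varying \<phi>"
    unfolding \<phi>_def[abs_def]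
    using Q_slowly_varying[OF \<beta>(4)] e_pos \<beta>
    by (intro slowly_varying_floor_mult[where l = "\<lambda>n. Q_LIS p n * real n powr \<beta>" and a = \<beta>]) auto
  moreover have "q_LIS p k = real k powr (- \<beta> - 1) * \<phi> (real k) \<and> Q_LIS p k = real k powr (- \<beta>) * \<Phi> (real k)"
    if "k \<ge> 1" for k
  proof -
    have k: "nat \<lfloor>max 1 (real k)\<rfloor> = k" using that by (simp add: max_def)
    have "real k powr (- \<beta>) * real k powr \<beta> = 1" using that by (simp flip: powr_add)
    moreover have "real k powr (- \<beta> - 1) = real k powr (- \<beta>) / k" using that by (simp add: powr_diff)
    ultimately show ?thesis
      using q_eq[OF that] by (simp add: \<phi>_def \<Phi>_def k)
  qed
  ultimately show ?thesis
    unfolding exponent by blast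
qed

end
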